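(* For all $\rho,\beta>0$ the radius of convexity $r^{c}(g_{\rho,\beta})$ of the function $g_{\rho,\beta}$ is the smallest positive root of the equation $(zg'_{\rho,\beta}(z))'=0$ and satisfies the inequalities $$\sqrt{\frac{\Gamma(\rho+\beta)}{9\Gamma(\beta)}}<r^{c}(g_{\rho,\beta})<\sqrt{\frac{9\Gamma(\rho+\beta)\Gamma(2\rho+\beta)}{\Delta_{81,25}(\rho,\beta)}}$$ and $$\sqrt[4]{\frac{\Gamma^{2}(\rho+\beta)\Gamma(2\rho+\beta)}{\Gamma(\beta)\Delta_{81,25}(\rho,\beta)}}<r^{c}(g_{\rho,\beta})<\sqrt{\frac{2\Gamma(\rho+\beta)\Gamma(3\rho+\beta)\Delta_{81,25}(\rho,\beta)}{\Gamma(\beta)\Gamma(3\rho+\beta)\Delta_{1458,675}(\rho,\beta)+49\Gamma^{3}(\rho+\beta)\Gamma(2\rho+\beta)}}.$$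
   Context: The Wright function is the entire function (of $z$) $\phi(\rho,\beta,z)=\sum_{n\ge 0}\frac{z^n}{n!\,\Gamma(n\rho+\beta)}$, and $g_{\rho,\beta}(z)=z\,\Gamma(\beta)\phi(\rho,\beta,-z^2)$. Notation: $\Delta_{a,b}(\rho,\beta)=a\,\Gamma(\beta)\Gamma(2\rho+\beta)-b\,\Gamma^2(\rho+\beta)$, and $\Gamma^k(x)=(\Gamma(x))^k$. For $r>0$ let $\mathbb{D}_r=\{z\in\mathbb{C}:|z|<r\}$. For an analytic $f$ normalized by $f(0)=f'(0)-1=0$, the radius of convexity (of order $0$) is $r^{c}(f)=\sup\{r>0:\ \operatorname{Re}(1+zf''(z)/f'(z))>0\ \text{for all } z\in\mathbb{D}_r\}$. *)

theory Defs
  imports "HOL-Complex_Analysis.Complex_Analysis"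
begin

definition wright :: "real \<Rightarrow> real \<Rightarrow> complex \<Rightarrow> complex" where
  "wright \<rho> \<beta> z = (\<Sum>n. z ^ n / of_real (fact n * Gamma (real n * \<rho> + \<beta>)))"

definition wright_g :: "real \<Rightarrow> real \<Rightarrow> complex \<Rightarrow> complex" where
  "wright_g \<rho> \<beta> z = z * of_real (Gamma \<beta>) * wright \<rho> \<beta> (- (z ^ 2))"

definition Delta :: "real \<Rightarrow> real \<Rightarrow> real \<Rightarrow> real \<Rightarrow> real" where
  "Delta a b \<rho> \<beta> = a * Gamma \<beta> * Gamma (2 * \<rho> + \<beta>) - b * Gamma (\<rho> + \<beta>) ^ 2"

(* The values are extended reals because the supremum may be infinite (for f z = z, say).
   The condition that deriv f z is nonzero expresses that the quotient is defined at z: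
   since x / 0 = 0, a critical point of f would otherwise satisfy the inequality.
   Intended for entire f. *)
definition radius_of_convexity :: "(complex \<Rightarrow> complex) \<Rightarrow> ereal" where
  "radius_of_convexity f =
     (SUP r \<in> {r :: real. r > 0 \<and>
        (\<forall>z \<in> ball 0 r. deriv f z \<noteq> 0 \<and>
           Re (1 + z * deriv (deriv f) z / deriv f z) > 0)}. ereal r)"

definition smallest_positive_root :: "(complex \<Rightarrow> complex) \<Rightarrow> real \<Rightarrow> bool" where
  "smallest_positive_root h r \<longleftrightarrow>
     r > 0 \<and> h (of_real r) = 0 \<and> (\<forall>s > 0. h (of_real s) = 0 \<longrightarrow> r \<le> s)"

end

theory Submission
  imports Defs "HOL-Computational_Algebra.Computational_Algebra" "HOL-Real_Asymp.Real_Asymp"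
begin

text \<open>
  Write \<open>(z g')' = F (z\<^sup>2)\<close> and \<open>g' = P (z\<^sup>2)\<close>, where the coefficients of \<open>F\<close> and \<open>P\<close> are
  \<open>(-1)\<^sup>n (2n + 1)\<^sup>e \<Gamma>(\<beta>) / (n! \<Gamma>(n \<rho> + \<beta>))\<close> with \<open>e = 2\<close> and \<open>e = 1\<close>. Following Laguerre, both are
  coefficientwise limits of polynomials with only positive roots, because multiplying the \<open>n\<close>-th
  coefficient by \<open>c + d n\<close> with \<open>c > 0\<close>, \<open>d \<ge> 0\<close> preserves this property. Hadamard's factorization is avoided:
  the coefficients \<open>\<sigma>\<^sub>n\<close> of \<open>- F' / F\<close> are limits of power sums of the reciprocal roots, so they are
  nonnegative, log-convex and submultiplicative. Nonnegativity makes the zero of smallest modulus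
  positive, and \<open>1 / r\<close> is the limit of \<open>\<sigma>\<^bsub>n+1\<^esub> / \<sigma>\<^sub>n\<close>, which gives the Euler-Rayleigh bounds. For \<open>P\<close> it gives
  \<open>Re (1 + z g'' / g') \<ge> 1 + 2 t P' t / P t = F t / P t > 0\<close> at \<open>t = \<bar>z\<bar>\<^sup>2\<close> below the first zero of \<open>F\<close>.
\<close>

section \<open>Polynomials with only positive roots and Laguerre's multipliers\<close>

definition pos_rooted :: "complex poly \<Rightarrow> bool" where
  "pos_rooted p \<longleftrightarrow> p \<noteq> 0 \<and> (\<forall>z. poly p z = 0 \<longrightarrow> Im z = 0 \<and> Re z > 0)"

text \<open>The factors are normalized to the value 1 at 0, so \<open>xs\<close> lists the
  reciprocals of the roots, whose power sums are the coefficients of the negated logarithmic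
  derivative. The fundamental theorem of algebra supplies a root \<open>t > 0\<close> to split off,
  and \<open>1 / t\<close> joins the list.\<close>

lemma pos_rooted_factorization:
  assumes "pos_rooted p"
  obtains c xs where "c \<noteq> 0" "\<forall>x\<in>set xs. x > 0"
    "p = smult c (\<Prod>x\<leftarrow>xs. [:1, - complex_of_real x:])"
proof -
  have "\<exists>c xs. c \<noteq> 0 \<and> (\<forall>x\<in>set xs. x > 0) \<and> p = smult c (\<Prod>x\<leftarrow>xs. [:1, - complex_of_real x:])"
    using assms
  proof (induction "degree p" arbitrary: p)
    case 0
    then obtain c where "p = [:c:]"
      by (metis degree_eq_zeroE)
    with 0 show ?case
      by (intro exI[of _ c] exI[of _ "[]"]) (auto simp: pos_rooted_def)
  next
    case (Suc d)
    then have "\<not> constant (poly p)"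
      by (simp add: constant_degree)
    then obtain z where z: "poly p z = 0"
      using fundamental_theorem_of_algebra by blast
    define t where "t = Re z"
    have t: "z = of_real t" "t > 0"
      using z Suc.prems by (auto simp: pos_rooted_def t_def complex_eq_iff)
    obtain q where q: "p = [:-z, 1:] * q"
      using z by (metis dvdE poly_eq_0_iff_dvd)
    have "q \<noteq> 0"
      using q Suc.prems by (auto simp: pos_rooted_def)
    moreover have "pos_rooted q"
      using Suc.prems \<open>q \<noteq> 0\<close> unfolding q pos_rooted_def by auto
    moreover have "degree p = degree [:-z, 1:] + degree q"
      unfolding q using \<open>q \<noteq> 0\<close> by (intro degree_mult_eq) auto
    ultimately obtain c xs where c: "c \<noteq> 0" "\<forall>x\<in>set xs. x > 0"
        "q = smult c (\<Prod>x\<leftarrow>xs. [:1, - complex_of_real x:])"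
      using Suc.hyps(1)[of q] Suc.hyps(2) by auto
    have "[:-z, 1:] = smult (- z) [:1, - complex_of_real (1 / t):]"
      using t by simp
    then have "p = smult (- z * c) (\<Prod>x\<leftarrow>(1 / t) # xs. [:1, - complex_of_real x:])"
      unfolding q c(3) list.map prod_list.Cons 
      by (simp only: mult_smult_left mult_smult_right smult_smult mult.commute)
    then show ?case
      using t c by (intro exI[of _ "- z * c"] exI[of _ "(1 / t) # xs"]) auto
  qed
  with that show thesis by blast
qed

text \<open>The logarithmic derivative of a product is the sum of those of its factors; the
  polynomial itself is kept as a factor on the right instead of a denominator on the left.\<close>

lemma poly_pderiv_prod_list_linear:
  assumes "\<forall>x\<in>set xs. 1 - of_real x * z \<noteq> 0"
  shows "z * poly (pderiv (\<Prod>x\<leftarrow>xs. [:1, - complex_of_real x:])) z =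
    poly (\<Prod>x\<leftarrow>xs. [:1, - complex_of_real x:]) z *
      (\<Sum>x\<leftarrow>xs. - (of_real x * z) / (1 - of_real x * z))"
  using assms
proof (induction xs)
  case (Cons x xs)
  define q where "q = (\<Prod>x\<leftarrow>xs. [:1, - complex_of_real x:])"
  define S where "S = (\<Sum>x\<leftarrow>xs. - (of_real x * z) / (1 - of_real x * z))"
  have IH: "z * poly (pderiv q) z = poly q z * S"
    using Cons by (simp add: q_def S_def)
  have nz: "1 - of_real x * z \<noteq> 0"
    using Cons.prems by simp
  have "poly (pderiv ([:1, - of_real x:] * q)) z =
      (1 - of_real x * z) * poly (pderiv q) z - of_real x * poly q z"
    by (simp only: pderiv_mult pderiv_pCons) (simp add: algebra_simps)
  then have "z * poly (pderiv ([:1, - of_real x:] * q)) z =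
      z * ((1 - of_real x * z) * poly (pderiv q) z - of_real x * poly q z)"
    by (rule arg_cong)
  also have "\<dots> = (1 - of_real x * z) * (z * poly (pderiv q) z) - of_real x * z * poly q z"
    by (simp add: algebra_simps)
  also have "\<dots> = poly ([:1, - of_real x:] * q) z * (- (of_real x * z) / (1 - of_real x * z) + S)"
    unfolding IH using nz by (simp add: divide_simps) (simp add: algebra_simps)
  finally show ?case
    by (simp only: q_def S_def list.map prod_list.Cons sum_list.Cons)
qed simp

lemma poly_prod_list_map: "poly (\<Prod>x\<leftarrow>xs. f x) z = (\<Prod>x\<leftarrow>xs. poly (f x) z)"
  by (induction xs) auto

lemma Im_summand:
  fixes x :: real and z :: complex
  shows "Im (- (of_real x * z) / (1 - of_real x * z)) = - (x * Im z) / (cmod (1 - of_real x * z))\<^sup>2"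
  by (simp add: Im_divide cmod_power2 algebra_simps)

text \<open>At a root of \<open>c p + d z p'\<close> that is not a root of \<open>p\<close>, the sum of
  \<open>x z / (1 - x z)\<close> is real and positive. All summands have imaginary part of the
  same sign as \<open>Im z\<close>, and for \<open>z \<le> 0\<close> they are nonpositive.\<close>

lemma pos_rooted_euler_step:
  fixes c d :: real
  assumes p: "pos_rooted p" and c: "c > 0" and d: "d \<ge> 0"
  shows "pos_rooted (smult (of_real c) p + smult (of_real d) (pCons 0 (pderiv p)))"
proof -
  define T where "T = smult (of_real c) p + smult (of_real d) (pCons 0 (pderiv p))"
  obtain C xs where C: "C \<noteq> 0" and xs: "\<forall>x\<in>set xs. x > 0"
    and p_eq: "p = smult C (\<Prod>x\<leftarrow>xs. [:1, - complex_of_real x:])"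
    using pos_rooted_factorization[OF p] .
  have poly_T: "poly T z = of_real c * poly p z + of_real d * (z * poly (pderiv p) z)" for z
    by (simp add: T_def)
  have "poly p 0 \<noteq> 0"
    using p by (auto simp: pos_rooted_def)
  then have "poly T 0 \<noteq> 0"
    using c by (simp add: poly_T)
  then have "T \<noteq> 0" by auto
  moreover have "Im z = 0 \<and> Re z > 0" if z: "poly T z = 0" for z
  proof (cases "poly p z = 0")
    case True
    then show ?thesis using p by (auto simp: pos_rooted_def)
  next
    case False
    then have nz: "\<forall>x\<in>set xs. 1 - of_real x * z \<noteq> 0"
      unfolding p_eq by (auto simp: poly_prod_list_map prod_list_zero_iff image_iff mult.commute)
    define u where "u = (\<lambda>x. - (of_real x * z) / (1 - of_real x * z))"
    have "z * poly (pderiv p) z = poly p z * (\<Sum>x\<leftarrow>xs. u x)"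
      unfolding u_def p_eq using poly_pderiv_prod_list_linear[OF nz]
      by (simp add: pderiv_smult mult_ac)
    then have "poly p z * (of_real c + of_real d * (\<Sum>x\<leftarrow>xs. u x)) = 0"
      using z by (simp add: poly_T algebra_simps)
    then have eq: "of_real c + of_real d * (\<Sum>x\<leftarrow>xs. u x) = 0"
      using False by simp
    \<comment> \<open>With \<open>d = 0\<close> or an empty list the left side of \<open>eq\<close>
      would be \<open>c\<close>, which is positive.\<close>
    have d0: "d > 0"
      using eq c d by (cases "d = 0") auto
    have xs0: "xs \<noteq> []"
      using eq c by auto
    have Re_list: "Re (\<Sum>x\<leftarrow>ys. u x) = (\<Sum>x\<leftarrow>ys. Re (u x))" for ys
      by (induction ys) auto
    have Im_list: "Im (\<Sum>x\<leftarrow>ys. u x) = - Im z * (\<Sum>x\<leftarrow>ys. x / (cmod (1 - of_real x * z))\<^sup>2)" for ys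
    proof (induction ys)
      case (Cons y ys)
      have "Im (u y) = - Im z * (y / (cmod (1 - of_real y * z))\<^sup>2)"
        unfolding u_def Im_summand by simp
      with Cons show ?case
        by (simp only: sum_list.Cons list.map plus_complex.sel distrib_left)
    qed simp
    have pos: "(\<Sum>x\<leftarrow>ys. x / (cmod (1 - of_real x * z))\<^sup>2) > 0"
      if "ys \<noteq> []" "set ys \<subseteq> set xs" for ys
      using that
    proof (induction ys rule: list_nonempty_induct)
      case (single x)
      then show ?case using nz xs by (auto intro!: divide_pos_pos)
    next
      case (cons x ys)
      then show ?case using nz xs by (auto intro!: add_pos_pos divide_pos_pos)
    qed
    have "Im (of_real c + of_real d * (\<Sum>x\<leftarrow>xs. u x)) = 0"
      unfolding eq by simp
    then have "Im z = 0"
      using d0 pos[of xs] xs0 by (simp add: Im_list)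
    moreover have "Re z > 0"
    proof (rule ccontr)
      assume "\<not> Re z > 0"
      have "Re (u x) \<ge> 0" if "x \<in> set xs" for x
      proof -
        define t where "t = Re z"
        have t: "z = of_real t" "t \<le> 0"
          using \<open>Im z = 0\<close> \<open>\<not> Re z > 0\<close> by (auto simp: t_def complex_eq_iff)
        have xt: "x * t \<le> 0"
          using xs that t by (simp add: mult_nonneg_nonpos less_imp_le)
        have "u x = of_real (- (x * t) / (1 - x * t))"
          unfolding u_def t by simp
        then have "Re (u x) = - (x * t) / (1 - x * t)"
          by simp
        also have "\<dots> \<ge> 0"
          using xt by (intro divide_nonneg_nonneg) auto
        finally show ?thesis .
      qed
      then have "Re (\<Sum>x\<leftarrow>xs. u x) \<ge> 0"
        unfolding Re_list by (intro sum_list_nonneg) auto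
      have "Re (of_real c + of_real d * (\<Sum>x\<leftarrow>xs. u x)) = 0"
        unfolding eq by simp
      then have "c + d * Re (\<Sum>x\<leftarrow>xs. u x) = 0"
        by simp
      moreover have "d * Re (\<Sum>x\<leftarrow>xs. u x) \<ge> 0"
        using d \<open>Re (\<Sum>x\<leftarrow>xs. u x) \<ge> 0\<close> by (intro mult_nonneg_nonneg)
      ultimately show False
        using c by linarith
    qed
    ultimately show ?thesis by blast
  qed
  ultimately show ?thesis
    unfolding pos_rooted_def T_def by blast
qed

text \<open>The operator \<open>c + d z d/dz\<close> multiplies the \<open>k\<close>-th coefficient
  by \<open>c + d k\<close>, so iterating \<open>pos_rooted_euler_step\<close> realizes any finite
  product of such factors.\<close>

lemma pos_rooted_multiplier:
  fixes c d :: "nat \<Rightarrow> real"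
  assumes "pos_rooted p" "\<And>j. j < m \<Longrightarrow> c j > 0" "\<And>j. j < m \<Longrightarrow> d j \<ge> 0"
  shows "\<exists>q. pos_rooted q \<and> (\<forall>k. coeff q k = of_real (\<Prod>j<m. c j + d j * real k) * coeff p k)"
  using assms
proof (induction m)
  case (Suc m)
  then obtain q where q: "pos_rooted q"
    "\<And>k. coeff q k = of_real (\<Prod>j<m. c j + d j * real k) * coeff p k"
    by (meson less_SucI)
  let ?r = "smult (of_real (c m)) q + smult (of_real (d m)) (pCons 0 (pderiv q))"
  have "pos_rooted ?r"
    using Suc.prems q by (intro pos_rooted_euler_step) auto
  moreover have "coeff ?r k = of_real (\<Prod>j<Suc m. c j + d j * real k) * coeff p k" for k
    by (cases k) (simp_all add: coeff_pderiv q(2) algebra_simps)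
  ultimately show ?case by blast
qed auto

lemma pos_rooted_linear_power:
  fixes s :: real
  assumes "s > 0"
  shows "pos_rooted ([:1, - of_real s:] ^ n)"
proof -
  have "Im z = 0 \<and> Re z > 0" if "1 = z * of_real s" for z
  proof -
    have "z = of_real (1 / s)"
      using that assms by (simp add: field_simps)
    then show ?thesis using assms by simp
  qed
  then show ?thesis
    by (auto simp: pos_rooted_def poly_power)
qed

section \<open>Formal power series, Rayleigh sums and power-sum inequalities\<close>

unbundle no vec_syntax
unbundle fps_syntax

text \<open>Inequalities and limits concern real coefficients, whereas zeros are located in the
  complex plane; this embedding links the two.\<close>

definition cfps :: "real fps \<Rightarrow> complex fps" where
  "cfps f = Abs_fps (\<lambda>n. of_real (f $ n))"

lemma cfps_nth [simp]: "cfps f $ n = of_real (f $ n)"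
  by (simp add: cfps_def)

lemma cfps_uminus: "cfps (- f) = - cfps f"
  by (simp add: fps_eq_iff)

lemma cfps_mult: "cfps (f * g) = cfps f * cfps g"
  by (simp add: fps_eq_iff fps_mult_nth)

lemma cfps_deriv: "cfps (fps_deriv f) = fps_deriv (cfps f)"
  by (simp add: fps_eq_iff)

lemma cfps_1: "cfps 1 = 1"
  by (simp add: fps_eq_iff)

lemma cfps_inverse:
  assumes "f $ 0 \<noteq> 0"
  shows "cfps (inverse f) = inverse (cfps f)"
proof -
  have "cfps f * cfps (inverse f) = 1"
    using assms by (simp add: cfps_mult[symmetric] inverse_mult_eq_1' cfps_1)
  then show ?thesis
    by (rule fps_inverse_unique [symmetric])
qed

lemma cfps_eq_iff: "cfps f = cfps g \<longleftrightarrow> f = g"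
  by (simp add: fps_eq_iff)

text \<open>If \<open>f\<close> has the zeros \<open>1 / x\<^sub>i\<close> (and genus \<open>0\<close>), then \<open>rayleigh f n\<close> is the sum of
  the \<open>x\<^sub>i ^ (n + 1)\<close>: note the shift of the exponent.\<close>

definition rayleigh_fps :: "real fps \<Rightarrow> real fps" where
  "rayleigh_fps f = - fps_deriv f * inverse f"

abbreviation rayleigh :: "real fps \<Rightarrow> nat \<Rightarrow> real" where
  "rayleigh f n \<equiv> rayleigh_fps f $ n"

lemma fps_deriv_rayleigh:
  assumes "f $ 0 \<noteq> 0"
  shows "fps_deriv f = - (f * rayleigh_fps f)"
proof -
  have "f * rayleigh_fps f = - (fps_deriv f * (inverse f * f))"
    by (simp add: rayleigh_fps_def mult_ac)
  then show ?thesis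
    using assms by (simp add: inverse_mult_eq_1)
qed

lemma rayleigh_fps_unique:
  assumes "f $ 0 \<noteq> 0" "fps_deriv f = - (f * S)"
  shows "rayleigh_fps f = S"
proof -
  have "rayleigh_fps f = (inverse f * f) * S"
    by (simp add: rayleigh_fps_def assms mult_ac)
  then show ?thesis
    using assms by (simp add: inverse_mult_eq_1)
qed

text \<open>Newton's identities: compare coefficients in \<open>f' = - f S\<close>. Isolating the
  term with \<open>f $ 0\<close> determines each sum from the earlier ones, which serves both for
  limits and for explicit values.\<close>

lemma rayleigh_rec:
  assumes "f $ 0 \<noteq> 0"
  shows "f $ 0 * rayleigh f n =
    - (real (n + 1) * f $ (n + 1)) - (\<Sum>i\<in>{1..n}. f $ i * rayleigh f (n - i))"
proof -
  have "fps_deriv f $ n = - (\<Sum>i\<in>{0..n}. f $ i * rayleigh f (n - i))"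
    by (subst fps_deriv_rayleigh[OF assms]) (simp add: fps_mult_nth)
  also have "(\<Sum>i\<in>{0..n}. f $ i * rayleigh f (n - i)) =
      f $ 0 * rayleigh f n + (\<Sum>i\<in>{1..n}. f $ i * rayleigh f (n - i))"
    by (simp add: sum.atLeast_Suc_atMost)
  finally show ?thesis by simp
qed

text \<open>By \<open>rayleigh_rec\<close> each Rayleigh sum is a rational function of finitely many
  coefficients, with only powers of \<open>f $ 0\<close> in the denominator. Coefficientwise
  convergence is therefore enough.\<close>

lemma tendsto_rayleigh:
  assumes lim: "\<And>k. (\<lambda>N. f N $ k) \<longlonglongrightarrow> g $ k"
    and nz: "\<And>N. f N $ 0 \<noteq> 0" "g $ 0 \<noteq> 0"
  shows "(\<lambda>N. rayleigh (f N) n) \<longlonglongrightarrow> rayleigh g n"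
proof (induction n rule: less_induct)
  case (less n)
  have eq: "rayleigh h n = (- (real (n + 1) * h $ (n + 1)) -
      (\<Sum>i\<in>{1..n}. h $ i * rayleigh h (n - i))) / h $ 0" if "h $ 0 \<noteq> 0" for h
    using rayleigh_rec[OF that, of n] that by (simp add: field_simps)
  have "(\<lambda>N. (- (real (n + 1) * f N $ (n + 1)) -
      (\<Sum>i\<in>{1..n}. f N $ i * rayleigh (f N) (n - i))) / f N $ 0) \<longlonglongrightarrow>
      (- (real (n + 1) * g $ (n + 1)) - (\<Sum>i\<in>{1..n}. g $ i * rayleigh g (n - i))) / g $ 0"
    by (intro tendsto_intros lim less nz) auto
  then show ?case
    using nz by (simp add: eq)
qed

text \<open>The inequalities between power sums of positive numbers that survive coefficientwise
  limits.\<close>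

definition power_sum_like :: "(nat \<Rightarrow> real) \<Rightarrow> bool" where
  "power_sum_like s \<longleftrightarrow> (\<forall>n. s n \<ge> 0) \<and> (\<forall>n. s (n + 1) ^ 2 \<le> s n * s (n + 2)) \<and>
    (\<forall>m n. s (m + n + 1) \<le> s m * s n)"

lemma power_sum_like_limit:
  assumes "\<And>N. power_sum_like (s N)" "\<And>n. (\<lambda>N. s N n) \<longlonglongrightarrow> t n"
  shows "power_sum_like t"
  unfolding power_sum_like_def
proof (intro conjI allI)
  fix m n
  show "t n \<ge> 0"
    using assms(1) by (intro LIMSEQ_le_const[OF assms(2)]) (auto simp: power_sum_like_def)
  show "t (n + 1) ^ 2 \<le> t n * t (n + 2)"
    using assms(1) by (intro LIMSEQ_le[OF tendsto_power[OF assms(2)] tendsto_mult[OF assms(2) assms(2)]])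
      (auto simp: power_sum_like_def)
  show "t (m + n + 1) \<le> t m * t n"
    using assms(1) by (intro LIMSEQ_le[OF assms(2) tendsto_mult[OF assms(2) assms(2)]])
      (auto simp: power_sum_like_def)
qed

text \<open>Log-convexity is the Cauchy-Schwarz inequality for the square roots of
  \<open>x ^ (n + 1)\<close> and \<open>x ^ (n + 3)\<close>. Submultiplicativity holds because the
  product of two sums contains the diagonal terms, and the mixed terms are nonnegative.\<close>

lemma power_sum_like_sum_list:
  fixes xs :: "real list"
  assumes "\<forall>x\<in>set xs. x > 0"
  shows "power_sum_like (\<lambda>n. \<Sum>x\<leftarrow>xs. x ^ (n + 1))"
  unfolding power_sum_like_def
proof (intro conjI allI)
  fix m n :: nat
  show nonneg: "(\<Sum>x\<leftarrow>xs. x ^ (n + 1)) \<ge> 0" for n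
    using assms by (intro sum_list_nonneg) (auto simp: less_imp_le)
  define I where "I = {..<length xs}"
  have pos: "xs ! i > 0" if "i \<in> I" for i
    using assms that by (auto simp: I_def)
  have sum_eq: "(\<Sum>x\<leftarrow>xs. x ^ k) = (\<Sum>i\<in>I. xs ! i ^ k)" for k
    by (simp add: I_def sum_list_sum_nth atLeast0LessThan)
  have "(\<Sum>i\<in>I. sqrt (xs ! i ^ (n + 1)) * sqrt (xs ! i ^ (n + 3))) ^ 2 \<le>
      (\<Sum>i\<in>I. sqrt (xs ! i ^ (n + 1)) ^ 2) * (\<Sum>i\<in>I. sqrt (xs ! i ^ (n + 3)) ^ 2)"
    by (rule Cauchy_Schwarz_ineq_sum)
  moreover have "sqrt (xs ! i ^ (n + 1)) * sqrt (xs ! i ^ (n + 3)) = xs ! i ^ (n + 2)" if "i \<in> I" for i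
  proof -
    have "xs ! i ^ (n + 1) * xs ! i ^ (n + 3) = (xs ! i ^ (n + 2)) ^ 2"
      by (simp add: power_add power2_eq_square power3_eq_cube)
    then show ?thesis
      using pos[OF that] by (simp only: real_sqrt_mult [symmetric] real_sqrt_abs) simp
  qed
  ultimately show "(\<Sum>x\<leftarrow>xs. x ^ (n + 1 + 1)) ^ 2 \<le>
      (\<Sum>x\<leftarrow>xs. x ^ (n + 1)) * (\<Sum>x\<leftarrow>xs. x ^ (n + 2 + 1))"
    unfolding sum_eq using pos by (simp add: less_imp_le numeral_3_eq_3)
  have nn: "(\<Sum>x\<leftarrow>ys. x ^ (k + 1)) \<ge> 0" if "set ys \<subseteq> set xs" for k ys
    using assms that by (intro sum_list_nonneg) (auto simp: less_imp_le subset_iff)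
  have "(\<Sum>x\<leftarrow>ys. x ^ (m + n + 2)) \<le> (\<Sum>x\<leftarrow>ys. x ^ (m + 1)) * (\<Sum>x\<leftarrow>ys. x ^ (n + 1))"
    if "set ys \<subseteq> set xs" for ys
    using that
  proof (induction ys)
    case (Cons y ys)
    have "y > 0" using Cons.prems assms by auto
    let ?A = "\<Sum>x\<leftarrow>ys. x ^ (m + 1)" and ?B = "\<Sum>x\<leftarrow>ys. x ^ (n + 1)"
    have "?A \<ge> 0" "?B \<ge> 0" using nn[of ys] Cons.prems by auto
    then have "0 \<le> y ^ (m + 1) * ?B" "0 \<le> ?A * y ^ (n + 1)"
      using \<open>y > 0\<close> by (intro mult_nonneg_nonneg; simp add: less_imp_le)+
    moreover have "(\<Sum>x\<leftarrow>ys. x ^ (m + n + 2)) \<le> ?A * ?B"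
      using Cons by simp
    moreover have "y ^ (m + n + 2) = y ^ (m + 1) * y ^ (n + 1)"
      by (simp add: power_add)
    ultimately have "y ^ (m + n + 2) + (\<Sum>x\<leftarrow>ys. x ^ (m + n + 2)) \<le>
        (y ^ (m + 1) + ?A) * (y ^ (n + 1) + ?B)"
      by (simp only: distrib_left distrib_right)
    then show ?case by simp
  qed simp
  from this[OF subset_refl] show "(\<Sum>x\<leftarrow>xs. x ^ (m + n + 1 + 1)) \<le>
      (\<Sum>x\<leftarrow>xs. x ^ (m + 1)) * (\<Sum>x\<leftarrow>xs. x ^ (n + 1))"
    by simp
qed

text \<open>Each factor \<open>1 - x z\<close> contributes the geometric series of
  \<open>x / (1 - x z)\<close>, whose \<open>n\<close>-th coefficient is \<open>x ^ (n + 1)\<close>;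
  the contributions add up under the product rule.\<close>

lemma fps_deriv_prod_list_linear:
  "fps_deriv (fps_of_poly (\<Prod>x\<leftarrow>xs. [:1, - complex_of_real x:])) =
    - (fps_of_poly (\<Prod>x\<leftarrow>xs. [:1, - complex_of_real x:]) *
        cfps (Abs_fps (\<lambda>n. \<Sum>x\<leftarrow>xs. x ^ (n + 1))))"
proof (induction xs)
  case Nil
  show ?case by (simp add: fps_eq_iff)
next
  case (Cons x xs)
  define L where "L = fps_of_poly [:1, - complex_of_real x:]"
  define Q where "Q = fps_of_poly (\<Prod>x\<leftarrow>xs. [:1, - complex_of_real x:])"
  define S where "S = cfps (Abs_fps (\<lambda>n. \<Sum>x\<leftarrow>xs. x ^ (n + 1)))"
  define G where "G = cfps (Abs_fps (\<lambda>n. x ^ (n + 1)))"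
  have L: "L = 1 - fps_const (of_real x) * fps_X"
    by (simp add: L_def fps_of_poly_pCons)
  have "L * G = fps_const (of_real x)"
  proof (rule fps_ext)
    fix n
    show "(L * G) $ n = fps_const (of_real x) $ n"
      unfolding L G_def by (cases n) (simp_all add: left_diff_distrib mult.assoc)
  qed
  moreover have "fps_deriv L = - fps_const (of_real x)"
    by (simp add: L)
  ultimately have dL: "fps_deriv L = - (L * G)" by simp
  have dQ: "fps_deriv Q = - (Q * S)"
    using Cons by (simp only: Q_def S_def)
  have "fps_deriv (L * Q) = - (L * Q * (G + S))"
    by (simp add: dL dQ algebra_simps)
  moreover have "G + S = cfps (Abs_fps (\<lambda>n. \<Sum>x\<leftarrow>x # xs. x ^ (n + 1)))"
    by (simp add: fps_eq_iff G_def S_def)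
  moreover have "L * Q = fps_of_poly (\<Prod>x\<leftarrow>x # xs. [:1, - complex_of_real x:])"
    unfolding L_def Q_def list.map prod_list.Cons by (rule fps_of_poly_mult [symmetric])
  ultimately show ?case by simp
qed

lemma power_sum_like_rayleigh_poly:
  assumes p: "pos_rooted p" and f: "cfps f = fps_of_poly p"
  shows "f $ 0 \<noteq> 0" "power_sum_like (rayleigh f)"
proof -
  obtain C xs where C: "C \<noteq> 0" and xs: "\<forall>x\<in>set xs. x > 0"
    and p_eq: "p = smult C (\<Prod>x\<leftarrow>xs. [:1, - complex_of_real x:])"
    using pos_rooted_factorization[OF p] .
  have "poly p 0 \<noteq> 0"
    using p by (auto simp: pos_rooted_def)
  moreover have "complex_of_real (f $ 0) = poly p 0"
    using arg_cong[OF f, of "\<lambda>F. F $ 0"] by (simp add: poly_0_coeff_0)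
  ultimately show f0: "f $ 0 \<noteq> 0" by auto
  define S where "S = Abs_fps (\<lambda>n. \<Sum>x\<leftarrow>xs. x ^ (n + 1))"
  have "cfps (fps_deriv f) = cfps (- (f * S))"
    unfolding cfps_deriv cfps_uminus cfps_mult f p_eq fps_of_poly_smult S_def
    by (simp only: fps_deriv_mult fps_deriv_prod_list_linear) (simp add: mult_ac)
  then have "rayleigh_fps f = S"
    by (intro rayleigh_fps_unique f0) (simp only: cfps_eq_iff)
  then show "power_sum_like (rayleigh f)"
    using power_sum_like_sum_list[OF xs] by (simp add: S_def)
qed

lemma power_sum_like_rayleigh_limit:
  assumes p: "\<And>N. pos_rooted (p N)" and f: "\<And>N. cfps (f N) = fps_of_poly (p N)"
    and lim: "\<And>k. (\<lambda>N. f N $ k) \<longlonglongrightarrow> g $ k" and g: "g $ 0 \<noteq> 0"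
  shows "power_sum_like (rayleigh g)"
proof (rule power_sum_like_limit)
  show "power_sum_like (rayleigh (f N))" for N
    by (rule power_sum_like_rayleigh_poly(2)[OF p f])
  show "(\<lambda>N. rayleigh (f N) n) \<longlonglongrightarrow> rayleigh g n" for n
    by (rule tendsto_rayleigh[OF lim power_sum_like_rayleigh_poly(1)[OF p f] g])
qed

section \<open>Zeros of entire functions with nonnegative Rayleigh sums\<close>

lemma fps_conv_radius_cfps [simp]: "fps_conv_radius (cfps f) = fps_conv_radius f"
  by (simp add: fps_conv_radius_def conv_radius_def)

lemma eval_cfps_of_real:
  assumes "ereal \<bar>t\<bar> < fps_conv_radius f"
  shows "eval_fps (cfps f) (of_real t) = of_real (eval_fps f t)"
proof -
  have "summable (\<lambda>n. f $ n * t ^ n)"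
    using assms by (intro summable_fps) simp
  from suminf_of_real[OF this, where 'a = complex] show ?thesis
    by (simp add: eval_fps_def)
qed

lemma norm_eval_cfps_le:
  assumes "\<And>n. f $ n \<ge> 0" "ereal (norm z) < fps_conv_radius f"
  shows "norm (eval_fps (cfps f) z) \<le> eval_fps f (norm z)"
proof -
  have "summable (\<lambda>n. norm (cfps f $ n * z ^ n))"
    using assms by (intro norm_summable_fps) simp
  from summable_norm[OF this] show ?thesis
    using assms(1) by (simp add: eval_fps_def norm_mult norm_power)
qed

text \<open>With \<open>S = - f' / f\<close> one has \<open>(1 / f)' = S (1 / f)\<close>, a
  recursion for the coefficients of \<open>1 / f\<close> in which all terms are nonnegative.\<close>

lemma rayleigh_nonneg_imp_inverse_nonneg:
  assumes "f $ 0 > 0" "\<And>n. rayleigh f n \<ge> 0"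
  shows "inverse f $ n \<ge> 0"
proof (induction n rule: less_induct)
  case (less n)
  show ?case
  proof (cases n)
    case 0
    with assms show ?thesis by simp
  next
    case (Suc m)
    have "fps_deriv (inverse f) = rayleigh_fps f * inverse f"
      using assms(1) by (simp add: fps_inverse_deriv rayleigh_fps_def power2_eq_square mult_ac)
    then have "real (Suc m) * inverse f $ (Suc m) =
        (\<Sum>i=0..m. rayleigh f i * inverse f $ (m - i))"
      by (metis fps_deriv_nth fps_mult_nth Suc_eq_plus1)
    also have "\<dots> \<ge> 0"
      using assms(2) less Suc by (intro sum_nonneg mult_nonneg_nonneg) auto
    finally show ?thesis
      unfolding Suc by (simp add: zero_le_mult_iff)
  qed
qed

text \<open>Nonnegativity suffices to locate the zero of least modulus and to bound
  \<open>f' / f\<close>; \<open>power_sum_like\<close> is assumed separately for the numerical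
  bounds. The locale is applied to both \<open>wright_fps 1\<close> and
  \<open>wright_fps 2\<close>.\<close>

locale entire_rayleigh =
  fixes f :: "real fps"
  assumes entire: "fps_conv_radius f = \<infinity>"
    and f_0: "f $ 0 = 1"
    and rayleigh_nonneg: "rayleigh f n \<ge> 0"
begin

lemma inverse_nonneg: "inverse f $ n \<ge> 0"
  by (rule rayleigh_nonneg_imp_inverse_nonneg) (simp_all add: f_0 rayleigh_nonneg)

lemma eval_of_real: "eval_fps (cfps f) (of_real t) = of_real (eval_fps f t)"
  by (rule eval_cfps_of_real) (simp add: entire)

lemma inverse_conv_radius:
  assumes "\<And>z. norm z < r \<Longrightarrow> eval_fps (cfps f) z \<noteq> 0"
  shows "fps_conv_radius (inverse f) \<ge> ereal r"
proof -
  have "fps_conv_radius (inverse (cfps f)) \<ge> min (ereal r) (fps_conv_radius (cfps f))"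
    by (rule fps_conv_radius_inverse) (use assms in auto)
  then show ?thesis
    by (simp add: f_0 entire flip: cfps_inverse)
qed

text \<open>Since \<open>f\<close> is entire, only its zeros can obstruct the convergence of the
  series of \<open>- f' / f\<close>. The converse is
  \<open>nonzero_in_rayleigh_disc\<close>.\<close>

lemma rayleigh_conv_radius:
  assumes "\<And>z. norm z < r \<Longrightarrow> eval_fps (cfps f) z \<noteq> 0"
  shows "fps_conv_radius (rayleigh_fps f) \<ge> ereal r"
proof -
  have "ereal r \<le> min (fps_conv_radius (- fps_deriv f)) (fps_conv_radius (inverse f))"
    using fps_conv_radius_deriv[of f] inverse_conv_radius[of r] assms by (simp add: entire)
  also have "\<dots> \<le> fps_conv_radius (rayleigh_fps f)"
    unfolding rayleigh_fps_def by (rule fps_conv_radius_mult)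
  finally show ?thesis .
qed

text \<open>Nonnegativity of the coefficients of \<open>inverse f\<close> makes \<open>\<bar>inverse f\<bar>\<close> on a circle maximal
  at the positive real point.\<close>

lemma eval_pos_le_norm:
  assumes nz: "\<And>z. norm z < r \<Longrightarrow> eval_fps (cfps f) z \<noteq> 0" and z: "norm z < r"
  shows "eval_fps f (norm z) > 0" "eval_fps f (norm z) \<le> norm (eval_fps (cfps f) z)"
proof -
  define X where "X = eval_fps (inverse f) (norm z)"
  have rad: "ereal (norm z) < fps_conv_radius (inverse f)"
    using inverse_conv_radius[of r] nz z by (meson less_ereal.simps(1) less_le_trans)
  have "eval_fps (inverse f * f) (norm z) = X * eval_fps f (norm z)"
    unfolding X_def using rad by (intro eval_fps_mult) (simp_all add: entire)
  then have X1: "X * eval_fps f (norm z) = 1"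
    by (simp add: inverse_mult_eq_1 f_0)
  have "eval_fps (cfps (inverse f) * cfps f) z = eval_fps (cfps (inverse f)) z * eval_fps (cfps f) z"
    using rad by (intro eval_fps_mult) (simp_all add: entire)
  then have "eval_fps (cfps (inverse f)) z * eval_fps (cfps f) z = 1"
    by (simp add: inverse_mult_eq_1 f_0 cfps_1 flip: cfps_mult)
  then have "1 = norm (eval_fps (cfps (inverse f)) z) * norm (eval_fps (cfps f) z)"
    by (metis norm_mult norm_one)
  also have "\<dots> \<le> X * norm (eval_fps (cfps f) z)"
    unfolding X_def by (intro mult_right_mono norm_eval_cfps_le inverse_nonneg rad) simp
  finally have X2: "1 \<le> X * norm (eval_fps (cfps f) z)" .
  have "X \<ge> 0"
    using X2 norm_ge_zero[of "eval_fps (cfps f) z"] by (smt (verit) mult_nonneg_nonneg mult_nonpos_nonneg)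
  moreover have "X \<noteq> 0" using X1 by auto
  ultimately have "X > 0" by simp
  then show "eval_fps f (norm z) > 0"
    using X1 by (metis zero_less_mult_pos zero_less_one)
  from X1 X2 have "X * eval_fps f (norm z) \<le> X * norm (eval_fps (cfps f) z)"
    by simp
  then show "eval_fps f (norm z) \<le> norm (eval_fps (cfps f) z)"
    using \<open>X > 0\<close> by simp
qed

lemma eval_pos:
  assumes "\<And>z. norm z < r \<Longrightarrow> eval_fps (cfps f) z \<noteq> 0" "0 \<le> t" "t < r"
  shows "eval_fps f t > 0"
  using eval_pos_le_norm(1)[OF assms(1), of r "of_real t"] assms by simp

lemma continuous_eval: "continuous_on UNIV (eval_fps f)"
  by (rule continuous_on_subset[OF continuous_on_eval_fps]) (simp add: entire)

lemma continuous_eval_complex: "continuous_on UNIV (eval_fps (cfps f))"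
  by (rule continuous_on_subset[OF continuous_on_eval_fps]) (simp add: entire)

text \<open>An argument in the manner of Pringsheim. Let \<open>z1\<close> be a zero of least
  modulus and let \<open>s\<close> increase to 1. Then
  \<open>0 \<le> f (s |z1|) \<le> |f (s z1)|\<close>, and the right side tends to 0, so
  \<open>|z1|\<close> is itself a zero.\<close>

lemma first_zero_positive:
  assumes "eval_fps (cfps f) z0 = 0"
  obtains r where "0 < r" "r \<le> norm z0" "eval_fps f r = 0"
    "\<And>z. norm z < r \<Longrightarrow> eval_fps (cfps f) z \<noteq> 0"
proof -
  define Z where "Z = {z. eval_fps (cfps f) z = 0}"
  have "closed Z"
    unfolding Z_def by (intro closed_Collect_eq continuous_eval_complex continuous_on_const)
  moreover have "Z \<noteq> {}"
    using assms by (auto simp: Z_def)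
  ultimately obtain z1 where z1: "z1 \<in> Z" "\<And>z. z \<in> Z \<Longrightarrow> norm z1 \<le> norm z"
    by (rule distance_attains_inf[where a = 0]) auto
  define r where "r = norm z1"
  have nz: "eval_fps (cfps f) z \<noteq> 0" if "norm z < r" for z
    using z1(2)[of z] that by (auto simp: Z_def r_def)
  have "z1 \<noteq> 0"
    using z1(1) by (auto simp: Z_def eval_fps_at_0 f_0)
  then have "r > 0" by (simp add: r_def)
  define s where "s = (\<lambda>n. real n / real (Suc n))"
  have s: "0 \<le> s n" "s n < 1" for n by (auto simp: s_def)
  have s_lim: "s \<longlonglongrightarrow> 1"
    unfolding s_def by (rule LIMSEQ_n_over_Suc_n)
  have norm_s: "norm (of_real (s n) * z1) = s n * r" for n
    using s[of n] by (simp add: norm_mult r_def)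
  have less: "s n * r < r" for n
    using s[of n] \<open>r > 0\<close> by simp
  have "(\<lambda>n. eval_fps f (s n * r)) \<longlonglongrightarrow> eval_fps f (1 * r)"
    by (rule continuous_on_tendsto_compose[OF continuous_eval tendsto_mult[OF s_lim tendsto_const]])
       simp_all
  moreover have "(\<lambda>n. norm (eval_fps (cfps f) (of_real (s n) * z1))) \<longlonglongrightarrow>
      norm (eval_fps (cfps f) (of_real 1 * z1))"
    by (rule tendsto_norm, rule continuous_on_tendsto_compose
         [OF continuous_eval_complex tendsto_mult[OF tendsto_of_real[OF s_lim] tendsto_const]])
       simp_all
  moreover have "0 \<le> eval_fps f (s n * r)"
    "eval_fps f (s n * r) \<le> norm (eval_fps (cfps f) (of_real (s n) * z1))" for n
    using eval_pos_le_norm[of r "of_real (s n) * z1"] nz norm_s[of n] less[of n] by (simp_all add: less_imp_le)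
  ultimately have "0 \<le> eval_fps f r" "eval_fps f r \<le> norm (eval_fps (cfps f) z1)"
    by (auto intro: LIMSEQ_le_const LIMSEQ_le)
  then have "eval_fps f r = 0"
    using z1(1) by (simp add: Z_def)
  moreover have "r \<le> norm z0"
    using z1(2)[of z0] assms by (simp add: Z_def r_def)
  ultimately show thesis
    using that \<open>r > 0\<close> nz by blast
qed

text \<open>Where the series \<open>S\<close> of \<open>- f' / f\<close> converges, it has a
  primitive \<open>h\<close>. From \<open>f' = - f S\<close> it follows that \<open>f exp h\<close>
  is constant, and its value at 0 is nonzero.\<close>

lemma nonzero_in_rayleigh_disc:
  assumes z: "ereal (norm z) < fps_conv_radius (rayleigh_fps f)"
  shows "eval_fps (cfps f) z \<noteq> 0"
proof -
  \<comment> \<open>The radius of convergence may be infinite; a real \<open>K\<close> below it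
    gives a ball on which the primitive exists.\<close>
  obtain K where K: "norm z < K" "ereal K < fps_conv_radius (rayleigh_fps f)"
    using ereal_dense2[OF z] by auto
  have sub: "ball (0 :: complex) K \<subseteq> eball 0 (fps_conv_radius (cfps (rayleigh_fps f)))"
  proof
    fix w :: complex
    assume "w \<in> ball 0 K"
    then have "ereal (norm w) < ereal K" by simp
    then show "w \<in> eball 0 (fps_conv_radius (cfps (rayleigh_fps f)))"
      using less_trans[OF _ K(2)] by simp
  qed
  define S where "S = eval_fps (cfps (rayleigh_fps f))"
  have "S holomorphic_on ball 0 K"
    unfolding S_def using sub by (rule holomorphic_on_eval_fps)
  then obtain h where h: "\<And>w. w \<in> ball 0 K \<Longrightarrow> (h has_field_derivative S w) (at w within ball 0 K)"
    using holomorphic_convex_primitive'[of "ball 0 K" S] by auto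
  define F where "F = eval_fps (cfps f)"
  have dF: "(F has_field_derivative (- (F w * S w))) (at w within A)" if "w \<in> ball 0 K" for w A
  proof -
    have "eval_fps (fps_deriv (cfps f)) w = eval_fps (- (cfps f * cfps (rayleigh_fps f))) w"
      by (simp add: fps_deriv_rayleigh f_0 cfps_uminus cfps_mult flip: cfps_deriv)
    also have "\<dots> = - eval_fps (cfps f * cfps (rayleigh_fps f)) w"
    proof (rule eval_fps_minus)
      have "ereal (norm w) < min (fps_conv_radius (cfps f)) (fps_conv_radius (cfps (rayleigh_fps f)))"
        using that sub by (auto simp: entire)
      also have "\<dots> \<le> fps_conv_radius (cfps f * cfps (rayleigh_fps f))"
        by (rule fps_conv_radius_mult)
      finally show "ereal (norm w) < fps_conv_radius (cfps f * cfps (rayleigh_fps f))" .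
    qed
    also have "eval_fps (cfps f * cfps (rayleigh_fps f)) w = F w * S w"
      unfolding F_def S_def using that sub by (intro eval_fps_mult) (auto simp: entire)
    finally have "eval_fps (fps_deriv (cfps f)) w = - (F w * S w)" .
    moreover have "(F has_field_derivative eval_fps (fps_deriv (cfps f)) w) (at w within A)"
      unfolding F_def by (rule has_field_derivative_eval_fps) (simp add: entire)
    ultimately show ?thesis by simp
  qed
  have "((\<lambda>w. F w * exp (h w)) has_field_derivative 0) (at w within ball 0 K)"
    if "w \<in> ball 0 K" for w
    by (rule derivative_eq_intros dF h that refl | simp)+
  then obtain c where c: "\<And>w. w \<in> ball 0 K \<Longrightarrow> F w * exp (h w) = c"
    using has_field_derivative_zero_constant[of "ball 0 K" "\<lambda>w. F w * exp (h w)"] by auto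
  have "K > 0" using K(1) norm_ge_zero[of z] by linarith
  then have "c \<noteq> 0"
    using c[of 0] by (auto simp: F_def eval_fps_at_0 f_0)
  then show ?thesis
    using c[of z] K(1) by (auto simp: F_def)
qed

text \<open>The series of \<open>- f' / f\<close> has nonnegative coefficients, so the triangle
  inequality bounds it on a circle by its value at the positive real point.\<close>

lemma log_deriv_le:
  assumes nz: "\<And>z. norm z < r \<Longrightarrow> eval_fps (cfps f) z \<noteq> 0" and z: "norm z < r"
  shows "norm (eval_fps (cfps (fps_deriv f)) z / eval_fps (cfps f) z) \<le>
    - eval_fps (fps_deriv f) (norm z) / eval_fps f (norm z)"
proof -
  have rad: "ereal (norm z) < fps_conv_radius (rayleigh_fps f)"
    using rayleigh_conv_radius[of r] nz z by (meson less_ereal.simps(1) less_le_trans)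
  have eq: "fps_deriv f = - (f * rayleigh_fps f)"
    by (rule fps_deriv_rayleigh) (simp add: f_0)
  have "ereal (norm z) < min (fps_conv_radius f) (fps_conv_radius (rayleigh_fps f))"
    using rad by (simp add: entire)
  also have "\<dots> \<le> fps_conv_radius (f * rayleigh_fps f)"
    by (rule fps_conv_radius_mult)
  finally have rad': "ereal (norm z) < fps_conv_radius (f * rayleigh_fps f)" .
  have "eval_fps (cfps (fps_deriv f)) z = - (eval_fps (cfps f) z * eval_fps (cfps (rayleigh_fps f)) z)"
    unfolding eq cfps_uminus using rad rad'
    by (subst eval_fps_minus) (simp, simp add: cfps_mult eval_fps_mult entire)
  then have "norm (eval_fps (cfps (fps_deriv f)) z / eval_fps (cfps f) z) =
      norm (eval_fps (cfps (rayleigh_fps f)) z)"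
    using nz[OF z] by (simp add: norm_mult norm_divide)
  also have "\<dots> \<le> eval_fps (rayleigh_fps f) (norm z)"
    by (rule norm_eval_cfps_le[OF rayleigh_nonneg rad])
  also have "\<dots> = - eval_fps (fps_deriv f) (norm z) / eval_fps f (norm z)"
  proof -
    have "eval_fps (fps_deriv f) (norm z) = - (eval_fps f (norm z) * eval_fps (rayleigh_fps f) (norm z))"
      unfolding eq using rad rad' by (simp add: eval_fps_minus eval_fps_mult entire)
    then show ?thesis
      using eval_pos_le_norm(1)[OF nz z] by simp
  qed
  finally show ?thesis .
qed

end

section \<open>Euler-Rayleigh bounds for the first zero\<close>

lemma power_sum_like_pos:
  assumes s: "power_sum_like s" and pos: "s 0 > 0" "s 1 > 0"
  shows "s n > 0"
proof -
  have "s n > 0 \<and> s (Suc n) > 0"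
  proof (induction n)
    case (Suc n)
    have "s (n + 1) ^ 2 \<le> s n * s (n + 2)"
      using s by (simp add: power_sum_like_def)
    moreover have "s (n + 1) ^ 2 > 0"
      using Suc by simp
    ultimately have "s n * s (n + 2) > 0" by linarith
    then show ?case
      using Suc by (simp add: zero_less_mult_iff)
  qed (use pos in auto)
  then show ?thesis by simp
qed

text \<open>\<open>L\<close> plays the part of the largest \<open>x\<^sub>i\<close>. Log-convexity
  makes the ratios increase and submultiplicativity bounds them by \<open>s 0\<close>. Telescoping
  gives \<open>s (m + k) / s m\<close> the limit \<open>L ^ k\<close>; for \<open>k = n + 1\<close>
  this quotient is at most \<open>s n\<close>.\<close>

lemma power_sum_like_ratio_limit:
  assumes s: "power_sum_like s" and pos: "s 0 > 0" "s 1 > 0"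
  obtains L where "L > 0" "(\<lambda>n. s (Suc n) / s n) \<longlonglongrightarrow> L"
    "\<And>n. s (Suc n) \<le> L * s n" "\<And>n. L ^ (n + 1) \<le> s n"
proof -
  have spos: "s n > 0" for n
    by (rule power_sum_like_pos[OF s pos])
  define q where "q = (\<lambda>n. s (Suc n) / s n)"
  have "q n \<le> q (Suc n)" for n
  proof -
    have "s (Suc n) * s (Suc n) \<le> s n * s (Suc (Suc n))"
      using s by (simp add: power_sum_like_def power2_eq_square)
    then show ?thesis
      using spos[of n] spos[of "Suc n"] by (simp add: q_def field_simps)
  qed
  then have "incseq q" by (rule incseq_SucI)
  moreover have "q n \<le> s 0" for n
  proof -
    have "s (n + 0 + 1) \<le> s n * s 0"
      using s unfolding power_sum_like_def by blast
    then show ?thesis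
      using spos[of n] by (simp add: q_def field_simps)
  qed
  ultimately obtain L where L: "q \<longlonglongrightarrow> L" "\<forall>i. q i \<le> L"
    using incseq_convergent by blast
  have "q 0 > 0"
    using pos by (simp add: q_def)
  then have "L > 0"
    using L(2) by (meson less_le_trans)
  moreover have "s (Suc n) \<le> L * s n" for n
    using L(2)[rule_format, of n] spos[of n] by (simp add: q_def field_simps)
  moreover have "L ^ (n + 1) \<le> s n" for n
  proof (rule LIMSEQ_le_const2)
    have "(\<lambda>m. s (m + k) / s m) \<longlonglongrightarrow> L ^ k" for k
    proof (induction k)
      case 0
      have "s m \<noteq> 0" for m
        using spos[of m] by simp
      then show ?case by simp
    next
      case (Suc k)
      have "(\<lambda>m. q (m + k) * (s (m + k) / s m)) \<longlonglongrightarrow> L * L ^ k"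
        by (intro tendsto_mult Suc LIMSEQ_ignore_initial_segment L)
      moreover have "q (m + k) * (s (m + k) / s m) = s (m + Suc k) / s m" for m
        using spos[of "m + k"] by (simp add: q_def)
      ultimately show ?case by (simp only: power_Suc)
    qed
    then show "(\<lambda>m. s (m + (n + 1)) / s m) \<longlonglongrightarrow> L ^ (n + 1)" .
    have "s (m + n + 1) \<le> s m * s n" for m
      using s by (simp add: power_sum_like_def)
    then have "s (m + (n + 1)) / s m \<le> s n" for m
      using spos[of m] by (simp add: field_simps)
    then show "\<exists>N. \<forall>m\<ge>N. s (m + (n + 1)) / s m \<le> s n" by blast
  qed
  ultimately show thesis
    using that L(1) unfolding q_def by blast
qed

text \<open>Equality \<open>s 2 = L * s 1\<close> would force all positive \<open>x\<^sub>i\<close> to be equal, so that \<open>f\<close> is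
  \<open>exp (- A z) (1 - L z) ^ m\<close>. The three-term recurrence of the coefficients of such a
  function is incompatible with \<open>b (n + 1) / b n\<close> tending to \<open>0\<close>.\<close>

lemma rayleigh_ratio_strict:
  fixes b :: "nat \<Rightarrow> real"
  assumes s: "power_sum_like (rayleigh f)" and L: "L > 0"
    and le: "\<And>n. rayleigh f (Suc n) \<le> L * rayleigh f n"
    and pos: "\<And>n. rayleigh f n > 0"
    and f: "\<And>n. f $ n = (-1) ^ n * b n / fact n" and b: "\<And>n. b n > 0"
    and ratio: "(\<lambda>n. b (Suc n) / b n) \<longlonglongrightarrow> 0"
  shows "rayleigh f 2 < L * rayleigh f 1"
proof (rule ccontr)
  define s where "s = rayleigh f"
  note s_def [symmetric, simp]
  assume "\<not> rayleigh f 2 < L * rayleigh f 1"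
  then have eq: "s 2 = L * s 1"
    using le[of 1] by (simp add: numeral_2_eq_2)
  \<comment> \<open>Equality propagates: log-convexity gives one inequality and the bound
    \<open>le\<close> the other.\<close>
  have step: "s (Suc (Suc n)) = L * s (Suc n)" for n
  proof (induction n)
    case 0
    show ?case using eq by (simp add: numeral_2_eq_2)
  next
    case (Suc n)
    have "s (Suc n + 1) ^ 2 \<le> s (Suc n) * s (Suc n + 2)"
      using s by (simp add: power_sum_like_def)
    then have "s (Suc n) * (L * s (Suc (Suc n))) \<le> s (Suc n) * s (Suc (Suc (Suc n)))"
      using Suc by (simp add: power2_eq_square mult_ac)
    then have "L * s (Suc (Suc n)) \<le> s (Suc (Suc (Suc n)))"
      using pos[of "Suc n"] by simp
    then show ?case
      using le[of "Suc (Suc n)"] by simp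
  qed
  have f0: "f $ 0 \<noteq> 0"
    using b[of 0] by (simp add: f)
  define c where "c = (\<lambda>n. \<Sum>i\<in>{0..n}. f $ i * s (n - i))"
  have fc: "real (Suc n) * f $ (Suc n) = - c n" for n
  proof -
    have "fps_deriv f $ n = - (f * rayleigh_fps f) $ n"
      by (subst fps_deriv_rayleigh[OF f0]) simp
    then show ?thesis
      by (simp add: fps_mult_nth c_def)
  qed
  \<comment> \<open>The values \<open>s k\<close> are geometric with ratio \<open>L\<close> only
    from \<open>k = 1\<close> on, so the terms with \<open>s 1\<close> and \<open>s 0\<close> are
    split off.\<close>
  have c_rec: "c (Suc n) = L * (c n - f $ n * s 0) + f $ n * s 1 + f $ (Suc n) * s 0" for n
  proof -
    have "c (Suc n) = (\<Sum>i\<in>{0..<n}. f $ i * s (Suc n - i)) + f $ n * s 1 + f $ (Suc n) * s 0"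
      by (simp add: c_def atLeastLessThanSuc_atLeastAtMost [symmetric])
    also have "(\<Sum>i\<in>{0..<n}. f $ i * s (Suc n - i)) = L * (\<Sum>i\<in>{0..<n}. f $ i * s (n - i))"
      unfolding sum_distrib_left
    proof (rule sum.cong)
      fix i assume "i \<in> {0..<n}"
      then have "n - i = Suc (n - i - 1)" "Suc n - i = Suc (Suc (n - i - 1))" by auto
      then have "s (Suc n - i) = L * s (n - i)"
        using step[of "n - i - 1"] by metis
      then show "f $ i * s (Suc n - i) = L * (f $ i * s (n - i))" by simp
    qed simp
    also have "(\<Sum>i\<in>{0..<n}. f $ i * s (n - i)) = c n - f $ n * s 0"
      by (simp add: c_def atLeastLessThanSuc_atLeastAtMost [symmetric])
    finally show ?thesis .
  qed
  have b_rec: "b (Suc (Suc n)) = (s 0 - L * real (Suc n)) * b (Suc n) + (L * s 0 - s 1) * real (Suc n) * b n" for n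
  proof -
    have "real (Suc (Suc n)) * f $ (Suc (Suc n)) =
        L * (real (Suc n) * f $ (Suc n)) + (L * s 0 - s 1) * f $ n - s 0 * f $ (Suc n)"
      unfolding fc c_rec by (simp add: algebra_simps)
    moreover have "real (Suc (Suc n)) * f $ (Suc (Suc n)) * ((-1) ^ n * fact (Suc n)) = b (Suc (Suc n))"
      by (simp add: f fact_Suc [of "Suc n"] del: fact_Suc)
    moreover have "f $ (Suc n) * ((-1) ^ n * fact (Suc n)) = - b (Suc n)"
      by (simp add: f del: fact_Suc)
    moreover have "f $ n * ((-1) ^ n * fact (Suc n)) = real (Suc n) * b n"
      by (simp add: f)
    ultimately have "b (Suc (Suc n)) = L * real (Suc n) * (- b (Suc n)) +
        (L * s 0 - s 1) * (real (Suc n) * b n) - s 0 * (- b (Suc n))"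
      by (metis (no_types, opaque_lifting) left_diff_distrib distrib_right mult.assoc)
    then show ?thesis by (simp add: algebra_simps)
  qed
  define q where "q = (\<lambda>n. b (Suc n) / b n)"
  have q: "q \<longlonglongrightarrow> 0"
    using ratio by (simp add: q_def)
  \<comment> \<open>This is \<open>b_rec\<close> divided by \<open>b n\<close> and by
    \<open>Suc n\<close>. The left side tends to 0 with \<open>q\<close>, so the constant on the
    right must vanish.\<close>
  have "q (Suc n) * q n / real (Suc n) - s 0 * (q n / real (Suc n)) + L * q n = L * s 0 - s 1" for n
  proof -
    have "q (Suc n) * q n = b (Suc (Suc n)) / b n"
      using b[of "Suc n"] by (simp add: q_def)
    also have "\<dots> = (s 0 - L * real (Suc n)) * q n + (L * s 0 - s 1) * real (Suc n)"
      using b[of n] unfolding b_rec by (simp add: q_def field_simps)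
    finally have e: "q (Suc n) * q n = (s 0 - L * real (Suc n)) * q n + (L * s 0 - s 1) * real (Suc n)" .
    have "real (Suc n) \<noteq> 0" by simp
    then show ?thesis
      unfolding e by (simp add: field_simps del: of_nat_Suc)
  qed
  moreover have "(\<lambda>n. q (Suc n) * q n / real (Suc n) - s 0 * (q n / real (Suc n)) + L * q n)
      \<longlonglongrightarrow> 0"
  proof -
    have inv: "(\<lambda>n. 1 / real (Suc n)) \<longlonglongrightarrow> 0"
      using LIMSEQ_inverse_real_of_nat by (simp add: field_simps)
    have "(\<lambda>n. q (Suc n) * q n * (1 / real (Suc n)) - s 0 * (q n * (1 / real (Suc n))) + L * q n)
        \<longlonglongrightarrow> 0 * 0 * 0 - s 0 * (0 * 0) + L * 0"
      by (intro tendsto_intros q inv LIMSEQ_Suc)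
    then show ?thesis by simp
  qed
  ultimately have "L * s 0 - s 1 = 0"
    by (simp only: LIMSEQ_const_iff)
  \<comment> \<open>The recurrence now has one term, whose factor becomes negative for large
    \<open>n\<close>, contrary to the positivity of \<open>b\<close>.\<close>
  then have "b (Suc (Suc n)) = (s 0 - L * real (Suc n)) * b (Suc n)" for n
    using b_rec[of n] by simp
  then have "(s 0 - L * real (Suc n)) * b (Suc n) > 0" for n
    using b by metis
  then have bound: "L * real (Suc n) < s 0" for n
    using b[of "Suc n"] by (metis zero_less_mult_pos2 diff_gt_0_iff_gt)
  obtain n where "s 0 / L < real n"
    using reals_Archimedean2 by blast
  then have "s 0 < L * real n"
    using L by (simp add: field_simps)
  with bound[of n] L show False
    by (simp add: algebra_simps)
qed

context entire_rayleigh
begin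

text \<open>The radius of convergence of \<open>rayleigh_fps f\<close> is \<open>1 / L\<close> by
  the ratio test and equals the first zero \<open>r\<close> by the two results on zero-free discs.
  Hence \<open>L = 1 / r\<close>, and inequalities between \<open>L\<close> and the Rayleigh sums
  become bounds for \<open>r\<close>.\<close>

lemma first_zero_rayleigh_bounds:
  fixes b :: "nat \<Rightarrow> real"
  assumes s: "power_sum_like (rayleigh f)" and pos: "rayleigh f 0 > 0" "rayleigh f 1 > 0"
    and f: "\<And>n. f $ n = (-1) ^ n * b n / fact n" and b: "\<And>n. b n > 0"
    and ratio: "(\<lambda>n. b (Suc n) / b n) \<longlonglongrightarrow> 0"
  obtains r where "r > 0" "eval_fps f r = 0"
    "\<And>z. norm z < r \<Longrightarrow> eval_fps (cfps f) z \<noteq> 0"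
    "1 / rayleigh f 0 < r" "r < rayleigh f 0 / rayleigh f 1"
    "1 / rayleigh f 1 < r ^ 2" "r < rayleigh f 1 / rayleigh f 2"
proof -
  obtain L where L: "L > 0" "(\<lambda>n. rayleigh f (Suc n) / rayleigh f n) \<longlonglongrightarrow> L"
    "\<And>n. rayleigh f (Suc n) \<le> L * rayleigh f n" "\<And>n. L ^ (n + 1) \<le> rayleigh f n"
    using power_sum_like_ratio_limit[OF s pos] by blast
  have spos: "rayleigh f n > 0" for n
    by (rule power_sum_like_pos[OF s pos])
  have "(\<lambda>n. inverse (rayleigh f (Suc n) / rayleigh f n)) \<longlonglongrightarrow> inverse L"
    using L by (intro tendsto_inverse) auto
  then have "(\<lambda>n. norm (rayleigh f n) / norm (rayleigh f (Suc n))) \<longlonglongrightarrow> inverse L"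
    using spos by (simp add: less_imp_le)
  then have radius: "fps_conv_radius (rayleigh_fps f) = ereal (inverse L)"
    unfolding fps_conv_radius_def using L(1) by (intro conv_radius_ratio_limit_nonzero) auto
  obtain z0 where z0: "eval_fps (cfps f) z0 = 0"
  proof (rule ccontr)
    assume "\<not> thesis"
    then have "eval_fps (cfps f) z \<noteq> 0" for z
      using that by blast
    \<comment> \<open>Without zeros the series would converge in every disc, also in one of twice
      its radius of convergence.\<close>
    then have "ereal (2 * inverse L) \<le> fps_conv_radius (rayleigh_fps f)"
      by (intro rayleigh_conv_radius)
    then show False
      using L(1) by (simp add: radius)
  qed
  obtain r where r: "0 < r" "eval_fps f r = 0"
    "\<And>z. norm z < r \<Longrightarrow> eval_fps (cfps f) z \<noteq> 0"
    using first_zero_positive[OF z0] by metis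
  have "r \<le> inverse L"
    using rayleigh_conv_radius[of r] r(3) by (simp add: radius)
  moreover have "r \<ge> inverse L"
    using nonzero_in_rayleigh_disc[of "of_real r"] r by (force simp: radius eval_of_real)
  ultimately have "r = inverse L" by simp
  then have Lr: "L = 1 / r"
    by (simp add: inverse_eq_divide)
  define s0 s1 s2 s3 where "s0 = rayleigh f 0" and "s1 = rayleigh f 1"
    and "s2 = rayleigh f 2" and "s3 = rayleigh f 3"
  note s_defs = s0_def s1_def s2_def s3_def
  have p: "s0 > 0" "s1 > 0" "s2 > 0" using spos by (auto simp: s_defs)
  \<comment> \<open>The source of strictness: all four strict bounds are derived from this
    one.\<close>
  have "s2 < L * s1"
    unfolding s_defs by (rule rayleigh_ratio_strict[OF s L(1,3) spos f b ratio])
  then have i1: "s2 * r < s1"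
    using r(1) by (simp add: Lr field_simps)
  have "s3 \<le> L * s2" "L ^ 4 \<le> s3"
    using L(3)[of 2] L(4)[of 3] by (simp_all add: s_defs numeral_eq_Suc)
  then have "L ^ 4 \<le> L * s2" by linarith
  then have "L ^ 3 \<le> s2"
    using L(1) by (simp add: power4_eq_xxxx power3_eq_cube)
  then have "1 \<le> s2 * r ^ 3"
    using r(1) by (simp add: Lr field_simps)
  also have "\<dots> < s1 * r ^ 2"
    using i1 r(1) mult_strict_right_mono[OF i1, of "r ^ 2"] by (simp add: power3_eq_cube power2_eq_square mult_ac)
  finally have i2: "1 < s1 * r ^ 2" .
  have "rayleigh f (0 + 1) ^ 2 \<le> rayleigh f 0 * rayleigh f (0 + 2)"
    "rayleigh f (0 + 0 + 1) \<le> rayleigh f 0 * rayleigh f 0"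
    using s unfolding power_sum_like_def by blast+
  then have h: "s1 * s1 \<le> s0 * s2" "s1 \<le> s0 * s0"
    by (simp_all add: s_defs power2_eq_square numeral_2_eq_2)
  have "s1 * s1 * r \<le> s0 * (s2 * r)"
    using mult_right_mono[OF h(1), of r] r(1) by (simp add: mult_ac)
  also have "\<dots> < s0 * s1"
    using i1 p by simp
  finally have i3: "s1 * r < s0"
    using p by (simp add: mult_ac)
  have "1 < (s0 * r) ^ 2"
    using i2 mult_right_mono[OF h(2), of "r ^ 2"] by (simp add: power2_eq_square mult_ac)
  then have i4: "1 < s0 * r"
    using p r(1) by (smt (verit) mult_nonneg_nonneg power_le_one)
  show thesis
    by (rule that[OF r(1,2,3)])
       (use i1 i2 i3 i4 p in \<open>simp_all add: s_defs field_simps\<close>)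
qed

end

section \<open>Limits and inequalities for Gamma quotients and binomials\<close>

lemma Gamma_midpoint:
  fixes x \<rho> :: real
  assumes "x > 0" "\<rho> > 0"
  shows "Gamma (x + \<rho>) ^ 2 \<le> Gamma x * Gamma (x + 2 * \<rho>)"
proof -
  have pos: "Gamma x > 0" "Gamma (x + \<rho>) > 0" "Gamma (x + 2 * \<rho>) > 0"
    using assms by (auto intro!: Gamma_real_pos)
  have "(ln \<circ> Gamma) ((1 - 1/2) *\<^sub>R x + (1/2) *\<^sub>R (x + 2 * \<rho>)) \<le>
      (1 - 1/2) * (ln \<circ> Gamma) x + (1/2) * (ln \<circ> Gamma) (x + 2 * \<rho>)"
    using assms by (intro convex_onD[OF log_convex_Gamma_real]) auto
  moreover have "(1 - 1/2) *\<^sub>R x + (1/2) *\<^sub>R (x + 2 * \<rho>) = x + \<rho>"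
    by (simp add: field_simps)
  ultimately have "2 * ln (Gamma (x + \<rho>)) \<le> ln (Gamma x) + ln (Gamma (x + 2 * \<rho>))"
    by simp
  then have "ln (Gamma (x + \<rho>) ^ 2) \<le> ln (Gamma x * Gamma (x + 2 * \<rho>))"
    using pos by (simp add: ln_mult ln_realpow)
  then show ?thesis
    using pos by (subst (asm) ln_le_cancel_iff) auto
qed

text \<open>By log-convexity the quotients decrease to some \<open>l \<ge> 0\<close>. If
  \<open>l > 0\<close>, then \<open>a (n + k) l ^ k \<le> a n\<close> for all \<open>n\<close> and
  \<open>k\<close>. For \<open>k \<rho> > 1\<close> the functional equation makes
  \<open>a (n + k)\<close> at least \<open>(n \<rho> + \<beta>) a n\<close>, which is impossible for
  large \<open>n\<close>.\<close>

lemma Gamma_ratio_tendsto_0: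
  fixes \<rho> \<beta> :: real
  assumes "\<rho> > 0" "\<beta> > 0"
  shows "(\<lambda>n. Gamma (real n * \<rho> + \<beta>) / Gamma (real (Suc n) * \<rho> + \<beta>)) \<longlonglongrightarrow> 0"
proof -
  define a where "a = (\<lambda>n. Gamma (real n * \<rho> + \<beta>))"
  have apos: "a n > 0" for n
    using assms by (auto simp: a_def intro!: Gamma_real_pos add_nonneg_pos)
  define u where "u = (\<lambda>n. a n / a (Suc n))"
  have upos: "u n > 0" for n
    using apos by (simp add: u_def)
  have "u (Suc n) \<le> u n" for n
  proof -
    have "a (Suc n) ^ 2 \<le> a n * a (Suc (Suc n))"
    proof -
      have "real n * \<rho> + \<beta> > 0"
        using assms by (intro add_nonneg_pos) auto
      from Gamma_midpoint[OF this assms(1)] show ?thesis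
        by (simp add: a_def algebra_simps)
    qed
    then show ?thesis
      using apos[of "Suc n"] apos[of "Suc (Suc n)"] by (simp add: u_def field_simps power2_eq_square)
  qed
  then have "decseq u" by (rule decseq_SucI)
  moreover have "\<forall>i. 0 \<le> u i"
    using upos by (auto simp: less_imp_le)
  ultimately obtain l where l: "u \<longlonglongrightarrow> l" "\<forall>i. l \<le> u i"
    by (rule decseq_convergent)
  have "l \<ge> 0"
    using l(1) upos by (intro LIMSEQ_le_const[of u]) (auto simp: less_imp_le)
  moreover have "\<not> l > 0"
  proof
    assume "l > 0"
    have bound: "a n * l ^ 0 \<ge> a (n + k) * l ^ k" for n k
    proof (induction k)
      case (Suc k)
      have "l * a (Suc (n + k)) \<le> a (n + k)"
        using l(2)[rule_format, of "n + k"] apos[of "Suc (n + k)"] by (simp add: u_def field_simps)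
      then have "l ^ k * (l * a (Suc (n + k))) \<le> l ^ k * a (n + k)"
        using \<open>l > 0\<close> by (intro mult_left_mono) auto
      with Suc show ?case by (simp add: mult_ac)
    qed simp
    obtain k where "1 / \<rho> < real k"
      using reals_Archimedean2 by blast
    then have k: "1 < real k * \<rho>"
      using assms by (simp add: field_simps)
    \<comment> \<open>The condition on \<open>n\<close> puts the arguments, which are at least 2,
      into the range where Gamma increases.\<close>
    have le: "(real n * \<rho> + \<beta>) * l ^ k \<le> 1" if "real n * \<rho> \<ge> 1" for n
    proof -
      have "(real n * \<rho> + \<beta>) * a n = Gamma (real n * \<rho> + \<beta> + 1)"
        using that assms by (simp add: a_def Gamma_plus1 nonpos_Ints_def)
      also have "\<dots> \<le> a (n + k)"
        unfolding a_def using k that assms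
        by (intro less_imp_le Gamma_real_strict_mono) (auto simp: algebra_simps)
      finally have "(real n * \<rho> + \<beta>) * a n * l ^ k \<le> a (n + k) * l ^ k"
        using \<open>l > 0\<close> by (intro mult_right_mono) auto
      also have "\<dots> \<le> a n"
        using bound[of n k] by simp
      finally show ?thesis
        using apos[of n] by (simp add: mult_ac mult_le_cancel_left1)
    qed
    obtain n where n: "(1 + 1 / l ^ k) / \<rho> < real n"
      using reals_Archimedean2 by blast
    then have n': "1 + 1 / l ^ k < real n * \<rho>"
      using assms by (simp add: field_simps)
    have "1 / l ^ k > 0"
      using \<open>l > 0\<close> by simp
    then have "real n * \<rho> \<ge> 1" "1 / l ^ k < real n * \<rho> + \<beta>"
      using n' assms by linarith+
    then show False
      using le[of n] \<open>l > 0\<close> by (simp add: field_simps)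
  qed
  ultimately have "l = 0" by simp
  with l(1) show ?thesis
    by (simp add: u_def a_def)
qed

lemma binomial_over_power_limit:
  "(\<lambda>n. real (n choose k) / real n ^ k) \<longlonglongrightarrow> 1 / fact k"
proof -
  have "(\<lambda>n. (\<Prod>i = 0..<k. 1 - real i * inverse (real n)) / fact k) \<longlonglongrightarrow>
      (\<Prod>i = 0..<k. 1 - real i * 0) / fact k"
    by (intro tendsto_intros lim_inverse_n) simp
  moreover have "eventually (\<lambda>n. (\<Prod>i = 0..<k. 1 - real i * inverse (real n)) / fact k =
      real (n choose k) / real n ^ k) sequentially"
    using eventually_gt_at_top[of 0]
  proof eventually_elim
    case (elim n)
    have "real n ^ k = (\<Prod>i = 0..<k. real n)" by simp
    then have "real (n choose k) / real n ^ k = (\<Prod>i = 0..<k. real n - real i) / (\<Prod>i = 0..<k. real n) / fact k"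
      by (simp only: binomial_gbinomial gbinomial_prod_rev) (simp add: field_simps)
    also have "(\<Prod>i = 0..<k. real n - real i) / (\<Prod>i = 0..<k. real n) =
        (\<Prod>i = 0..<k. 1 - real i * inverse (real n))"
      unfolding prod_dividef [symmetric] using elim by (intro prod.cong) (auto simp: field_simps)
    finally show ?case by simp
  qed
  ultimately show ?thesis
    by (simp add: filterlim_cong)
qed

section \<open>Power series attached to the Wright function\<close>

text \<open>The exponent \<open>e\<close> counts derivatives: at \<open>z\<^sup>2\<close> the series
  built from these coefficients is \<open>g / z\<close>, \<open>g'\<close> and
  \<open>(z g')'\<close> for \<open>e = 0, 1, 2\<close>. The factor \<open>Gamma \<beta>\<close>
  normalizes the constant term to 1.\<close>

definition wright_coeff :: "nat \<Rightarrow> real \<Rightarrow> real \<Rightarrow> nat \<Rightarrow> real" where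
  "wright_coeff e \<rho> \<beta> n = real (2 * n + 1) ^ e * Gamma \<beta> / Gamma (real n * \<rho> + \<beta>)"

definition wright_fps :: "nat \<Rightarrow> real \<Rightarrow> real \<Rightarrow> real fps" where
  "wright_fps e \<rho> \<beta> = Abs_fps (\<lambda>n. (-1) ^ n * wright_coeff e \<rho> \<beta> n / fact n)"

lemma coeff_one_minus_power:
  "coeff ([:1, - of_real s:] ^ n) k = complex_of_real (real (n choose k) * (- s) ^ k)"
proof (cases "k \<le> n")
  case False
  then have "degree ([:1, - complex_of_real s:] ^ n) < k"
    using degree_power_le[of "[:1, - complex_of_real s:]" n] by (auto simp: split: if_splits)
  with False show ?thesis by (simp add: coeff_eq_0)
qed (simp add: coeff_linear_poly_power)

lemma pos_rooted_smult: "pos_rooted p \<Longrightarrow> c \<noteq> 0 \<Longrightarrow> pos_rooted (smult c p)"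
  by (simp add: pos_rooted_def)

text \<open>By Euler's product, \<open>1 / \<Gamma>(k \<rho> + \<beta>)\<close> is the limit of products of linear factors
  \<open>k \<rho> + \<beta> + j\<close>, and each of these is the action of a multiplier on the coefficients of
  \<open>(1 - s z) ^ N\<close>.\<close>

lemma power_sum_like_rayleigh_wright:
  assumes "\<rho> > 0" "\<beta> > 0"
  shows "power_sum_like (rayleigh (wright_fps e \<rho> \<beta>))"
proof -
  \<comment> \<open>At \<open>k \<rho> + \<beta>\<close> the Euler product divides by
    \<open>N!\<close> and by \<open>N\<close> to the power \<open>k \<rho> + \<beta>\<close>. The
    scale \<open>s\<close> absorbs the part depending on \<open>k\<close>, together with the
    \<open>N ^ k\<close> that tames the binomial coefficient; \<open>C\<close> collects the
    rest.\<close>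
  define s where "s = (\<lambda>N. 1 / (real N * exp (\<rho> * ln (real N))))"
  define C where "C = (\<lambda>N. Gamma \<beta> / (fact N * exp (\<beta> * ln (real N))))"
  define h where "h = (\<lambda>N. Abs_fps (\<lambda>k. C N * (real (2 * k + 1) ^ e *
    (pochhammer (real k * \<rho> + \<beta>) (N + 1) * (real (N choose k) * (- s N) ^ k)))))"
  have "\<exists>p. pos_rooted p \<and> cfps (h N) = fps_of_poly p" if "N > 0" for N
  proof -
    have "s N > 0" using that by (simp add: s_def)
    then have "pos_rooted ([:1, - of_real (s N):] ^ N)"
      by (rule pos_rooted_linear_power)
    then obtain p where p: "pos_rooted p"
      "\<And>k. coeff p k = of_real (\<Prod>j<N+1. (\<beta> + real j) + \<rho> * real k) * coeff ([:1, - of_real (s N):] ^ N) k"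
      using pos_rooted_multiplier[of _ "N + 1" "\<lambda>j. \<beta> + real j" "\<lambda>_. \<rho>"] assms by (auto simp: add_pos_nonneg)
    obtain q where q: "pos_rooted q"
      "\<And>k. coeff q k = of_real (\<Prod>j<e. 1 + 2 * real k) * coeff p k"
      using pos_rooted_multiplier[OF p(1), of e "\<lambda>_. 1" "\<lambda>_. 2"] by auto
    have "C N \<noteq> 0"
      using Gamma_real_pos[OF assms(2)] by (simp add: C_def)
    then have "pos_rooted (smult (of_real (C N)) q)"
      using q(1) by (simp add: pos_rooted_smult)
    moreover have "(\<Prod>j<N+1. (\<beta> + real j) + \<rho> * real k) = pochhammer (real k * \<rho> + \<beta>) (N + 1)" for k
      unfolding pochhammer_prod atLeast0LessThan by (intro prod.cong) (auto simp: algebra_simps)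
    then have "cfps (h N) = fps_of_poly (smult (of_real (C N)) q)"
      by (intro fps_ext) (simp add: h_def q(2) p(2) coeff_one_minus_power algebra_simps)
    ultimately show ?thesis by blast
  qed
  \<comment> \<open>The index is shifted because \<open>s 0 = 0\<close> by division by zero.\<close>
  then have "\<exists>p. \<forall>N. pos_rooted (p N) \<and> cfps (h (Suc N)) = fps_of_poly (p N)"
    by (intro choice) simp
  then obtain p where p: "\<And>N. pos_rooted (p N)" "\<And>N. cfps (h (Suc N)) = fps_of_poly (p N)"
    by blast
  have lim: "(\<lambda>N. h (Suc N) $ k) \<longlonglongrightarrow> wright_fps e \<rho> \<beta> $ k" for k
  proof (rule LIMSEQ_Suc)
    let ?x = "real k * \<rho> + \<beta>"
    have "(\<lambda>N. (-1) ^ k * real (2 * k + 1) ^ e * Gamma \<beta> * rGamma_series ?x N *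
        (real (N choose k) / real N ^ k)) \<longlonglongrightarrow>
        (-1) ^ k * real (2 * k + 1) ^ e * Gamma \<beta> * rGamma ?x * (1 / fact k)"
      by (intro tendsto_intros rGamma_series_LIMSEQ binomial_over_power_limit)
    moreover have "(-1) ^ k * real (2 * k + 1) ^ e * Gamma \<beta> * rGamma ?x * (1 / fact k) =
        wright_fps e \<rho> \<beta> $ k"
      by (simp add: wright_fps_def wright_coeff_def Gamma_def field_simps)
    moreover have "h N $ k = (-1) ^ k * real (2 * k + 1) ^ e * Gamma \<beta> * rGamma_series ?x N *
        (real (N choose k) / real N ^ k)" for N
    proof -
      have "exp (?x * ln (real N)) = exp (\<rho> * ln (real N)) ^ k * exp (\<beta> * ln (real N))"
        by (simp add: exp_of_nat_mult [symmetric] exp_add [symmetric] algebra_simps)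
      moreover have "(- s N) ^ k = (-1) ^ k / (real N ^ k * exp (\<rho> * ln (real N)) ^ k)"
        by (simp add: s_def power_minus [of "1 / _"] power_divide power_mult_distrib)
      ultimately show ?thesis
        by (simp add: h_def C_def rGamma_series_def mult_ac)
    qed
    ultimately show "(\<lambda>N. h N $ k) \<longlonglongrightarrow> wright_fps e \<rho> \<beta> $ k"
      by simp
  qed
  have "wright_fps e \<rho> \<beta> $ 0 \<noteq> 0"
    using Gamma_real_pos[OF assms(2)] by (simp add: wright_fps_def wright_coeff_def)
  from power_sum_like_rayleigh_limit[OF p lim this] show ?thesis .
qed

lemma wright_coeff_pos: "\<rho> > 0 \<Longrightarrow> \<beta> > 0 \<Longrightarrow> wright_coeff e \<rho> \<beta> n > 0"
  by (auto simp: wright_coeff_def intro!: divide_pos_pos mult_pos_pos Gamma_real_pos add_nonneg_pos)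

lemma wright_coeff_ratio:
  assumes "\<rho> > 0" "\<beta> > 0"
  shows "(\<lambda>n. wright_coeff e \<rho> \<beta> (Suc n) / wright_coeff e \<rho> \<beta> n) \<longlonglongrightarrow> 0"
proof -
  have "(\<lambda>n. real (2 * Suc n + 1) / real (2 * n + 1)) \<longlonglongrightarrow> 1"
    by real_asymp
  then have "(\<lambda>n. (real (2 * Suc n + 1) / real (2 * n + 1)) ^ e *
      (Gamma (real n * \<rho> + \<beta>) / Gamma (real (Suc n) * \<rho> + \<beta>))) \<longlonglongrightarrow> 1 ^ e * 0"
    by (intro tendsto_intros Gamma_ratio_tendsto_0 assms)
  moreover have "Gamma \<beta> \<noteq> 0"
    using Gamma_real_pos[OF assms(2)] by simp
  ultimately show ?thesis
    by (simp add: wright_coeff_def power_divide mult_ac del: of_nat_Suc)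
qed

text \<open>The quotient of consecutive coefficients is \<open>(n + 1) / q n\<close> in modulus, and
  \<open>q\<close> tends to 0.\<close>

lemma wright_fps_conv_radius:
  assumes "\<rho> > 0" "\<beta> > 0"
  shows "fps_conv_radius (wright_fps e \<rho> \<beta>) = \<infinity>"
  unfolding fps_conv_radius_def
proof (rule conv_radius_ratio_limit_ereal)
  note pos = wright_coeff_pos[OF assms, of e]
  show "eventually (\<lambda>n. wright_fps e \<rho> \<beta> $ n \<noteq> 0) sequentially"
    using pos by (auto simp: wright_fps_def less_imp_neq[symmetric] dest: less_imp_neq)
  define q where "q = (\<lambda>n. wright_coeff e \<rho> \<beta> (Suc n) / wright_coeff e \<rho> \<beta> n)"
  have lim: "filterlim (\<lambda>n. inverse (q n)) at_top sequentially"
    using wright_coeff_ratio[OF assms] pos unfolding q_def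
    by (intro filterlim_inverse_at_top) auto
  have le: "inverse (q n) \<le> norm (wright_fps e \<rho> \<beta> $ n) / norm (wright_fps e \<rho> \<beta> $ Suc n)" for n
  proof -
    have "norm (wright_fps e \<rho> \<beta> $ n) / norm (wright_fps e \<rho> \<beta> $ Suc n) = real (Suc n) * inverse (q n)"
      using pos[of n] pos[of "Suc n"] by (simp add: wright_fps_def abs_mult q_def field_simps)
    moreover have "inverse (q n) > 0"
      using pos by (simp add: q_def)
    ultimately show ?thesis by simp
  qed
  have "filterlim (\<lambda>n. norm (wright_fps e \<rho> \<beta> $ n) / norm (wright_fps e \<rho> \<beta> $ Suc n)) at_top sequentially"
    by (rule filterlim_at_top_mono[OF lim always_eventually[OF allI[OF le]]])
  then show "(\<lambda>n. ereal (norm (wright_fps e \<rho> \<beta> $ n) / norm (wright_fps e \<rho> \<beta> $ Suc n))) \<longlonglongrightarrow> \<infinity>"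
    by (simp add: tendsto_PInfty_eq_at_top)
qed

lemma entire_rayleigh_wright:
  assumes "\<rho> > 0" "\<beta> > 0"
  shows "entire_rayleigh (wright_fps e \<rho> \<beta>)"
proof
  show "fps_conv_radius (wright_fps e \<rho> \<beta>) = \<infinity>"
    by (rule wright_fps_conv_radius[OF assms])
  show "wright_fps e \<rho> \<beta> $ 0 = 1"
    using Gamma_real_pos[OF assms(2)] by (simp add: wright_fps_def wright_coeff_def)
  show "rayleigh (wright_fps e \<rho> \<beta>) n \<ge> 0" for n
    using power_sum_like_rayleigh_wright[OF assms, of e] by (simp add: power_sum_like_def)
qed

section \<open>Derivatives of \<open>wright_g\<close> and the convexity condition\<close>

lemma wright_g_eq:
  assumes "\<rho> > 0" "\<beta> > 0"
  shows "wright_g \<rho> \<beta> z = z * eval_fps (cfps (wright_fps 0 \<rho> \<beta>)) (z\<^sup>2)"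
proof -
  let ?t = "\<lambda>n. (- (z\<^sup>2)) ^ n / complex_of_real (fact n * Gamma (real n * \<rho> + \<beta>))"
  have G: "Gamma \<beta> \<noteq> 0"
    using Gamma_real_pos[OF assms(2)] by simp
  have eq: "cfps (wright_fps 0 \<rho> \<beta>) $ n * (z\<^sup>2) ^ n = of_real (Gamma \<beta>) * ?t n" for n
    unfolding power_minus [of "z\<^sup>2"] by (simp add: wright_fps_def wright_coeff_def field_simps)
  have "summable (\<lambda>n. cfps (wright_fps 0 \<rho> \<beta>) $ n * (z\<^sup>2) ^ n)"
    by (rule summable_fps) (simp add: wright_fps_conv_radius[OF assms])
  then have "summable (\<lambda>n. of_real (Gamma \<beta>) * ?t n)"
    by (simp only: eq)
  then have "summable ?t"
    by (rule summable_mult_D) (use G in simp)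
  then have "eval_fps (cfps (wright_fps 0 \<rho> \<beta>)) (z\<^sup>2) = of_real (Gamma \<beta>) * (\<Sum>n. ?t n)"
    unfolding eval_fps_def eq by (rule suminf_mult)
  then show ?thesis
    by (simp add: wright_g_def wright_def mult_ac)
qed

text \<open>The extra factor \<open>2 n + 1\<close> on the coefficients is the operator
  \<open>1 + 2 w d/dw\<close>; by the chain rule this is also what turns
  \<open>z h(z\<^sup>2)\<close> into its derivative.\<close>

lemma eval_wright_fps_Suc:
  assumes "\<rho> > 0" "\<beta> > 0"
  shows "eval_fps (cfps (wright_fps (Suc e) \<rho> \<beta>)) w =
    eval_fps (cfps (wright_fps e \<rho> \<beta>)) w + 2 * w * eval_fps (fps_deriv (cfps (wright_fps e \<rho> \<beta>))) w"
proof -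
  let ?F = "cfps (wright_fps e \<rho> \<beta>)"
  have "cfps (wright_fps (Suc e) \<rho> \<beta>) = ?F + fps_const 2 * (fps_X * fps_deriv ?F)"
  proof (rule fps_ext)
    fix n
    have "wright_fps (Suc e) \<rho> \<beta> $ n = real (2 * n + 1) * wright_fps e \<rho> \<beta> $ n"
      by (simp add: wright_fps_def wright_coeff_def)
    then have "cfps (wright_fps (Suc e) \<rho> \<beta>) $ n = (2 * of_nat n + 1) * ?F $ n"
      by simp
    moreover have "(fps_X * fps_deriv ?F) $ n = of_nat n * ?F $ n"
      by (cases n) simp_all
    ultimately show "cfps (wright_fps (Suc e) \<rho> \<beta>) $ n = (?F + fps_const 2 * (fps_X * fps_deriv ?F)) $ n"
      by (simp add: distrib_right)
  qed
  moreover have rad: "fps_conv_radius ?F = \<infinity>"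
    by (simp add: wright_fps_conv_radius[OF assms])
  have rad': "fps_conv_radius (fps_deriv ?F) = \<infinity>"
    using fps_conv_radius_deriv[of ?F] by (simp add: wright_fps_conv_radius[OF assms])
  have rad'': "fps_conv_radius (fps_X * fps_deriv ?F) = \<infinity>"
    using fps_conv_radius_mult[of fps_X "fps_deriv ?F"] by (simp add: rad')
  have rad''': "fps_conv_radius (fps_const 2 * (fps_X * fps_deriv ?F)) = \<infinity>"
    using fps_conv_radius_mult[of "fps_const 2" "fps_X * fps_deriv ?F"] by (simp add: rad'')
  ultimately show ?thesis
    by (simp add: eval_fps_add eval_fps_mult wright_fps_conv_radius[OF assms] rad' rad'' rad''')
qed

lemma has_field_derivative_eval_wright_square:
  assumes "\<rho> > 0" "\<beta> > 0"
  shows "((\<lambda>z. eval_fps (cfps (wright_fps e \<rho> \<beta>)) (z\<^sup>2)) has_field_derivative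
    2 * z * eval_fps (fps_deriv (cfps (wright_fps e \<rho> \<beta>))) (z\<^sup>2)) (at z)"
proof -
  have "(eval_fps (cfps (wright_fps e \<rho> \<beta>)) has_field_derivative
      eval_fps (fps_deriv (cfps (wright_fps e \<rho> \<beta>))) (z\<^sup>2)) (at (z\<^sup>2))"
    by (rule has_field_derivative_eval_fps) (simp add: wright_fps_conv_radius[OF assms])
  moreover have "((\<lambda>z. z\<^sup>2) has_field_derivative 2 * z) (at z)"
    by (auto intro!: derivative_eq_intros)
  ultimately have "((\<lambda>z. eval_fps (cfps (wright_fps e \<rho> \<beta>)) (z\<^sup>2)) has_field_derivative
      eval_fps (fps_deriv (cfps (wright_fps e \<rho> \<beta>))) (z\<^sup>2) * (2 * z)) (at z)"
    by (rule DERIV_chain2)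
  then show ?thesis
    by (simp only: mult_ac)
qed

lemma deriv_mult_eval_wright_square:
  assumes "\<rho> > 0" "\<beta> > 0"
  shows "deriv (\<lambda>z. z * eval_fps (cfps (wright_fps e \<rho> \<beta>)) (z\<^sup>2)) =
    (\<lambda>z. eval_fps (cfps (wright_fps (Suc e) \<rho> \<beta>)) (z\<^sup>2))"
proof
  fix z
  show "deriv (\<lambda>z. z * eval_fps (cfps (wright_fps e \<rho> \<beta>)) (z\<^sup>2)) z =
      eval_fps (cfps (wright_fps (Suc e) \<rho> \<beta>)) (z\<^sup>2)"
    using DERIV_mult[OF DERIV_ident has_field_derivative_eval_wright_square[OF assms, of e z]]
    by (intro DERIV_imp_deriv) (simp add: eval_wright_fps_Suc[OF assms] power2_eq_square mult_ac)
qed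

text \<open>Everything becomes a function of \<open>w = z\<^sup>2\<close>. The first equation holds
  also at zeros of \<open>g'\<close>, since both sides divide by the same value.\<close>

lemma convexity_quotient:
  assumes "\<rho> > 0" "\<beta> > 0"
  shows "1 + z * deriv (deriv (wright_g \<rho> \<beta>)) z / deriv (wright_g \<rho> \<beta>) z =
      1 + 2 * z\<^sup>2 * eval_fps (fps_deriv (cfps (wright_fps 1 \<rho> \<beta>))) (z\<^sup>2) /
        eval_fps (cfps (wright_fps 1 \<rho> \<beta>)) (z\<^sup>2)"
    and "deriv (wright_g \<rho> \<beta>) z = eval_fps (cfps (wright_fps 1 \<rho> \<beta>)) (z\<^sup>2)"
    and "deriv (\<lambda>z. z * deriv (wright_g \<rho> \<beta>) z) z = eval_fps (cfps (wright_fps 2 \<rho> \<beta>)) (z\<^sup>2)"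
proof -
  have g: "wright_g \<rho> \<beta> = (\<lambda>z. z * eval_fps (cfps (wright_fps 0 \<rho> \<beta>)) (z\<^sup>2))"
    using wright_g_eq[OF assms] by blast
  have d: "deriv (wright_g \<rho> \<beta>) = (\<lambda>z. eval_fps (cfps (wright_fps 1 \<rho> \<beta>)) (z\<^sup>2))"
    unfolding g by (simp add: deriv_mult_eval_wright_square[OF assms])
  then show "deriv (wright_g \<rho> \<beta>) z = eval_fps (cfps (wright_fps 1 \<rho> \<beta>)) (z\<^sup>2)" by simp
  show "deriv (\<lambda>z. z * deriv (wright_g \<rho> \<beta>) z) z = eval_fps (cfps (wright_fps 2 \<rho> \<beta>)) (z\<^sup>2)"
    unfolding d by (simp only: deriv_mult_eval_wright_square[OF assms] Suc_1)
  have "deriv (deriv (wright_g \<rho> \<beta>)) z = 2 * z * eval_fps (fps_deriv (cfps (wright_fps 1 \<rho> \<beta>))) (z\<^sup>2)"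
    unfolding d by (rule DERIV_imp_deriv has_field_derivative_eval_wright_square assms)+
  then show "1 + z * deriv (deriv (wright_g \<rho> \<beta>)) z / deriv (wright_g \<rho> \<beta>) z =
      1 + 2 * z\<^sup>2 * eval_fps (fps_deriv (cfps (wright_fps 1 \<rho> \<beta>))) (z\<^sup>2) /
        eval_fps (cfps (wright_fps 1 \<rho> \<beta>)) (z\<^sup>2)"
    unfolding d by (simp add: power2_eq_square)
qed

text \<open>With \<open>P = wright_fps 1\<close> and \<open>F = wright_fps 2 = P + 2 w P'\<close>, a zero of \<open>P\<close> in the disc
  would give a first positive zero \<open>t\<close> of \<open>P\<close>, where \<open>P' \<le> 0\<close> and hence \<open>F t \<le> 0\<close>.\<close>

lemma wright_convexity_disc:
  assumes "\<rho> > 0" "\<beta> > 0"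
    and nz: "\<And>w. norm w < r \<Longrightarrow> eval_fps (cfps (wright_fps 2 \<rho> \<beta>)) w \<noteq> 0"
    and w: "norm w < r"
  shows "eval_fps (cfps (wright_fps 1 \<rho> \<beta>)) w \<noteq> 0"
    and "Re (1 + 2 * w * eval_fps (fps_deriv (cfps (wright_fps 1 \<rho> \<beta>))) w /
      eval_fps (cfps (wright_fps 1 \<rho> \<beta>)) w) > 0"
proof -
  define P where "P = wright_fps 1 \<rho> \<beta>"
  define F where "F = wright_fps 2 \<rho> \<beta>"
  interpret P: entire_rayleigh P
    unfolding P_def by (rule entire_rayleigh_wright[OF assms(1,2)])
  interpret F: entire_rayleigh F
    unfolding F_def by (rule entire_rayleigh_wright[OF assms(1,2)])
  have radP': "fps_conv_radius (fps_deriv P) = \<infinity>"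
    using fps_conv_radius_deriv[of P] by (simp add: P.entire)
  have FP: "eval_fps F t = eval_fps P t + 2 * t * eval_fps (fps_deriv P) t" for t
  proof -
    have "of_real (eval_fps F t) = complex_of_real (eval_fps P t + 2 * t * eval_fps (fps_deriv P) t)"
      using eval_wright_fps_Suc[OF assms(1,2), of 1 "of_real t"]
      unfolding Suc_1 P_def [symmetric] F_def [symmetric] F.eval_of_real P.eval_of_real
        cfps_deriv [symmetric]
      by (simp add: eval_cfps_of_real radP')
    then show ?thesis
      by (simp only: of_real_eq_iff)
  qed
  have Fpos: "eval_fps F t > 0" if "0 \<le> t" "t < r" for t
    using F.eval_pos[of r t] nz that by (simp add: F_def)
  have P_nz: "eval_fps (cfps P) z \<noteq> 0" if "norm z < r" for z
  proof
    assume "eval_fps (cfps P) z = 0"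
    then obtain t where t: "0 < t" "t \<le> norm z" "eval_fps P t = 0"
      "\<And>z. norm z < t \<Longrightarrow> eval_fps (cfps P) z \<noteq> 0"
      using P.first_zero_positive by metis
    \<comment> \<open>\<open>F t > 0\<close> and \<open>P t = 0\<close> force
      \<open>P' t > 0\<close>, so \<open>P\<close> is negative just left of \<open>t\<close>,
      although it is positive before its first zero.\<close>
    have "2 * t * eval_fps (fps_deriv P) t > 0"
      using Fpos[of t] FP[of t] t that by simp
    then have "eval_fps (fps_deriv P) t > 0"
      using t(1) by (simp add: zero_less_mult_iff)
    moreover have "(eval_fps P has_real_derivative eval_fps (fps_deriv P) t) (at t)"
      by (rule has_field_derivative_eval_fps) (simp add: P.entire)
    ultimately obtain d where d: "d > 0" "\<And>h. h > 0 \<Longrightarrow> h < d \<Longrightarrow> eval_fps P (t - h) < eval_fps P t"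
      using DERIV_pos_inc_left by blast
    define h where "h = min d t / 2"
    have h: "h > 0" "h < d" "h < t"
      using d(1) t(1) by (auto simp: h_def)
    have "eval_fps P (t - h) > 0"
      using P.eval_pos[of t "t - h"] t(4) h by simp
    with d(2)[of h] h t(3) show False by simp
  qed
  then show "eval_fps (cfps (wright_fps 1 \<rho> \<beta>)) w \<noteq> 0"
    using w by (simp add: P_def)
  define t where "t = norm w"
  have t: "0 \<le> t" "t < r"
    using w by (simp_all add: t_def)
  define u where "u = eval_fps (cfps (fps_deriv P)) w / eval_fps (cfps P) w"
  have Ppos: "eval_fps P t > 0"
    using P.eval_pos[of r t] P_nz t by simp
  have "norm u \<le> - eval_fps (fps_deriv P) t / eval_fps P t"
    unfolding u_def t_def by (rule P.log_deriv_le[OF P_nz w])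
  then have "2 * t * norm u \<le> 2 * t * (- eval_fps (fps_deriv P) t / eval_fps P t)"
    using t(1) by (intro mult_left_mono) auto
  then have "norm (2 * w * u) \<le> 2 * t * (- eval_fps (fps_deriv P) t / eval_fps P t)"
    by (simp add: norm_mult t_def)
  moreover have "- Re (2 * w * u) \<le> norm (2 * w * u)"
    using abs_Re_le_cmod[of "2 * w * u"] by linarith
  ultimately have "Re (1 + 2 * w * u) \<ge> 1 + 2 * t * (eval_fps (fps_deriv P) t / eval_fps P t)"
    by simp
  moreover have "1 + 2 * t * (eval_fps (fps_deriv P) t / eval_fps P t) = eval_fps F t / eval_fps P t"
    using Ppos by (simp add: FP field_simps)
  moreover have "eval_fps F t / eval_fps P t > 0"
    using Fpos[OF t] Ppos by simp
  ultimately have "Re (1 + 2 * w * u) > 0" by linarith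
  then show "Re (1 + 2 * w * eval_fps (fps_deriv (cfps (wright_fps 1 \<rho> \<beta>))) w /
      eval_fps (cfps (wright_fps 1 \<rho> \<beta>)) w) > 0"
    by (simp add: u_def P_def cfps_deriv)
qed

section \<open>Explicit Rayleigh sums and the radius of convexity\<close>

text \<open>Newton's identities with the squares 9, 25 and 49 of 3, 5 and 7. Over the common
  denominator the constants of the last sum are \<open>1458 = 2 * 9 ^ 3\<close> and
  \<open>675 = 3 * 9 * 25\<close>.\<close>

lemma rayleigh_wright:
  assumes "\<rho> > 0" "\<beta> > 0"
  shows "rayleigh (wright_fps 2 \<rho> \<beta>) 0 = 9 * Gamma \<beta> / Gamma (\<rho> + \<beta>)"
    and "rayleigh (wright_fps 2 \<rho> \<beta>) 1 =
      Gamma \<beta> * Delta 81 25 \<rho> \<beta> / (Gamma (\<rho> + \<beta>) ^ 2 * Gamma (2 * \<rho> + \<beta>))"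
    and "rayleigh (wright_fps 2 \<rho> \<beta>) 2 =
      Gamma \<beta> * (Gamma \<beta> * Gamma (3 * \<rho> + \<beta>) * Delta 1458 675 \<rho> \<beta>
               + 49 * Gamma (\<rho> + \<beta>) ^ 3 * Gamma (2 * \<rho> + \<beta>)) /
      (2 * Gamma (\<rho> + \<beta>) ^ 3 * Gamma (2 * \<rho> + \<beta>) * Gamma (3 * \<rho> + \<beta>))"
proof -
  define G G1 G2 G3 where G: "G = Gamma \<beta>" "G1 = Gamma (\<rho> + \<beta>)" "G2 = Gamma (2 * \<rho> + \<beta>)"
    "G3 = Gamma (3 * \<rho> + \<beta>)"
  have pos: "G > 0" "G1 > 0" "G2 > 0" "G3 > 0"
    using assms by (auto simp: G intro!: Gamma_real_pos)
  define f where "f = wright_fps 2 \<rho> \<beta>"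
  have f: "f $ 0 = 1" "f $ 1 = - (9 * G / G1)" "f $ 2 = 25 * G / G2 / 2" "f $ 3 = - (49 * G / G3 / 6)"
    using pos by (simp_all add: f_def wright_fps_def wright_coeff_def G fact_numeral)
  have f0: "f $ 0 \<noteq> 0" by (simp add: f)
  have s0: "rayleigh f 0 = 9 * G / G1"
    using rayleigh_rec[OF f0, of 0] f by simp
  have s1: "rayleigh f 1 = (9 * G / G1) ^ 2 - 25 * G / G2"
    using rayleigh_rec[OF f0, of 1] f s0 by (simp add: power2_eq_square numeral_2_eq_2)
  have "{1..2::nat} = {1, 2}" by auto
  then have "rayleigh f 2 = - (3 * f $ 3) - (f $ 1 * rayleigh f 1 + f $ 2 * rayleigh f 0)"
    using rayleigh_rec[OF f0, of 2] f(1) by simp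
  then have s2: "rayleigh f 2 = 49 * G / G3 / 2 + 9 * G / G1 * ((9 * G / G1) ^ 2 - 25 * G / G2)
      - 25 * G / G2 / 2 * (9 * G / G1)"
    unfolding f s0 s1 by simp
  show "rayleigh (wright_fps 2 \<rho> \<beta>) 0 = 9 * Gamma \<beta> / Gamma (\<rho> + \<beta>)"
    using s0 by (simp add: f_def G)
  show "rayleigh (wright_fps 2 \<rho> \<beta>) 1 =
      Gamma \<beta> * Delta 81 25 \<rho> \<beta> / (Gamma (\<rho> + \<beta>) ^ 2 * Gamma (2 * \<rho> + \<beta>))"
    unfolding f_def[symmetric] s1 Delta_def G[symmetric] using pos
    by (simp add: field_simps power2_eq_square)
  show "rayleigh (wright_fps 2 \<rho> \<beta>) 2 =
      Gamma \<beta> * (Gamma \<beta> * Gamma (3 * \<rho> + \<beta>) * Delta 1458 675 \<rho> \<beta>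
               + 49 * Gamma (\<rho> + \<beta>) ^ 3 * Gamma (2 * \<rho> + \<beta>)) /
      (2 * Gamma (\<rho> + \<beta>) ^ 3 * Gamma (2 * \<rho> + \<beta>) * Gamma (3 * \<rho> + \<beta>))"
    unfolding f_def[symmetric] s2 Delta_def G[symmetric] using pos
    by (simp add: field_simps power2_eq_square power3_eq_cube)
qed

lemma Delta_81_25_pos:
  assumes "\<rho> > 0" "\<beta> > 0"
  shows "Delta 81 25 \<rho> \<beta> > 0"
proof -
  have "Gamma (\<rho> + \<beta>) ^ 2 \<le> Gamma \<beta> * Gamma (2 * \<rho> + \<beta>)"
    using Gamma_midpoint[of \<beta> \<rho>] assms by (simp add: add.commute)
  moreover have "Gamma \<beta> * Gamma (2 * \<rho> + \<beta>) > 0"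
    using assms by (intro mult_pos_pos Gamma_real_pos) auto
  ultimately have "25 * Gamma (\<rho> + \<beta>) ^ 2 < 81 * (Gamma \<beta> * Gamma (2 * \<rho> + \<beta>))"
    by linarith
  then show ?thesis
    by (simp add: Delta_def mult.assoc)
qed

theorem theorem6:
  fixes \<rho> \<beta> :: real
  assumes "\<rho> > 0" and "\<beta> > 0"
  shows "\<exists>r :: real. radius_of_convexity (wright_g \<rho> \<beta>) = ereal r \<and>
    smallest_positive_root (deriv (\<lambda>z. z * deriv (wright_g \<rho> \<beta>) z)) r \<and>
    sqrt (Gamma (\<rho> + \<beta>) / (9 * Gamma \<beta>)) < r \<and>
    r < sqrt (9 * Gamma (\<rho> + \<beta>) * Gamma (2 * \<rho> + \<beta>) / Delta 81 25 \<rho> \<beta>) \<and>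
    root 4 (Gamma (\<rho> + \<beta>) ^ 2 * Gamma (2 * \<rho> + \<beta>) / (Gamma \<beta> * Delta 81 25 \<rho> \<beta>)) < r \<and>
    r < sqrt (2 * Gamma (\<rho> + \<beta>) * Gamma (3 * \<rho> + \<beta>) * Delta 81 25 \<rho> \<beta> /
              (Gamma \<beta> * Gamma (3 * \<rho> + \<beta>) * Delta 1458 675 \<rho> \<beta>
               + 49 * Gamma (\<rho> + \<beta>) ^ 3 * Gamma (2 * \<rho> + \<beta>)))"
proof -
  define F where "F = wright_fps 2 \<rho> \<beta>"
  interpret F: entire_rayleigh F
    unfolding F_def by (rule entire_rayleigh_wright[OF assms])
  have G: "Gamma \<beta> > 0" "Gamma (\<rho> + \<beta>) > 0" "Gamma (2 * \<rho> + \<beta>) > 0" "Gamma (3 * \<rho> + \<beta>) > 0"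
    using assms by (auto intro!: Gamma_real_pos)
  note D = Delta_81_25_pos[OF assms]
  note s = rayleigh_wright[OF assms, folded F_def]
  have pos: "rayleigh F 0 > 0" "rayleigh F 1 > 0"
    using G D by (simp_all only: s) simp_all
  obtain R where R: "R > 0" "eval_fps F R = 0" "\<And>z. norm z < R \<Longrightarrow> eval_fps (cfps F) z \<noteq> 0"
    "1 / rayleigh F 0 < R" "R < rayleigh F 0 / rayleigh F 1"
    "1 / rayleigh F 1 < R ^ 2" "R < rayleigh F 1 / rayleigh F 2"
  proof (rule F.first_zero_rayleigh_bounds[OF _ pos])
    show "power_sum_like (rayleigh F)"
      unfolding F_def by (rule power_sum_like_rayleigh_wright[OF assms])
    show "F $ n = (-1) ^ n * wright_coeff 2 \<rho> \<beta> n / fact n" for n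
      by (simp add: F_def wright_fps_def)
  qed (use wright_coeff_pos[OF assms] wright_coeff_ratio[OF assms] in auto)
  \<comment> \<open>\<open>R\<close> is a zero in the variable \<open>z\<^sup>2\<close>.\<close>
  define r where "r = sqrt R"
  have r: "r > 0" "r\<^sup>2 = R"
    using R(1) by (simp_all add: r_def)
  have convex: "deriv (wright_g \<rho> \<beta>) z \<noteq> 0 \<and>
      Re (1 + z * deriv (deriv (wright_g \<rho> \<beta>)) z / deriv (wright_g \<rho> \<beta>) z) > 0"
    if "z \<in> ball 0 r" for z
  proof -
    have "norm (z\<^sup>2) < R"
      using that r by (simp add: norm_power power_strict_mono flip: r(2))
    from wright_convexity_disc[OF assms R(3)[unfolded F_def] this] show ?thesis
      unfolding convexity_quotient(1)[OF assms] unfolding convexity_quotient(2)[OF assms] by blast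
  qed
  have "radius_of_convexity (wright_g \<rho> \<beta>) = ereal r"
    unfolding radius_of_convexity_def
  proof (rule antisym)
    show "ereal r \<le> (SUP r\<in>{r. r > 0 \<and> (\<forall>z\<in>ball 0 r. deriv (wright_g \<rho> \<beta>) z \<noteq> 0 \<and>
        Re (1 + z * deriv (deriv (wright_g \<rho> \<beta>)) z / deriv (wright_g \<rho> \<beta>) z) > 0)}. ereal r)"
      using r(1) convex by (intro SUP_upper) auto
    show "(SUP r\<in>{r. r > 0 \<and> (\<forall>z\<in>ball 0 r. deriv (wright_g \<rho> \<beta>) z \<noteq> 0 \<and>
        Re (1 + z * deriv (deriv (wright_g \<rho> \<beta>)) z / deriv (wright_g \<rho> \<beta>) z) > 0)}. ereal r) \<le> ereal r"
    proof (rule SUP_least, clarify)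
      fix q :: real
      assume q: "\<forall>z\<in>ball 0 q. deriv (wright_g \<rho> \<beta>) z \<noteq> 0 \<and>
        Re (1 + z * deriv (deriv (wright_g \<rho> \<beta>)) z / deriv (wright_g \<rho> \<beta>) z) > 0"
      show "ereal q \<le> ereal r"
      proof (rule ccontr)
        assume "\<not> ereal q \<le> ereal r"
        then have in_ball: "complex_of_real r \<in> ball 0 q"
          using r(1) by simp
        let ?P = "cfps (wright_fps 1 \<rho> \<beta>)"
        \<comment> \<open>That \<open>g'\<close> does not vanish at \<open>r\<close> is part of the
          condition on \<open>q\<close>. It makes the quotient genuine there, and
          \<open>F R = 0\<close> then says that the convexity expression is 0.\<close>
        have "eval_fps ?P (of_real R) \<noteq> 0"
          using q in_ball by (auto simp: convexity_quotient(2)[OF assms] simp flip: r(2) simp del: One_nat_def)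
        moreover have "eval_fps ?P (of_real R) + 2 * of_real R * eval_fps (fps_deriv ?P) (of_real R) = 0"
          using eval_wright_fps_Suc[OF assms, of 1 "of_real R"] R(2)
          unfolding Suc_1 F_def [symmetric] F.eval_of_real by simp
        ultimately have "1 + 2 * of_real R * eval_fps (fps_deriv ?P) (of_real R) / eval_fps ?P (of_real R) = 0"
          by (simp add: field_simps)
        then have "1 + of_real r * deriv (deriv (wright_g \<rho> \<beta>)) (of_real r) /
            deriv (wright_g \<rho> \<beta>) (of_real r) = 0"
          unfolding convexity_quotient(1)[OF assms] by (simp flip: r(2) del: One_nat_def)
        then show False
          using q in_ball by (metis less_irrefl zero_complex.simps(1))
      qed
    qed
  qed
  moreover have "smallest_positive_root (deriv (\<lambda>z. z * deriv (wright_g \<rho> \<beta>) z)) r"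
    unfolding smallest_positive_root_def convexity_quotient(3)[OF assms] F_def[symmetric]
  proof (intro conjI allI impI)
    show "r > 0" by (rule r)
    show "eval_fps (cfps F) ((complex_of_real r)\<^sup>2) = 0"
      using R(2) r(2) F.eval_of_real[of R] by (simp flip: of_real_power)
    fix x :: real
    assume x: "x > 0" "eval_fps (cfps F) ((complex_of_real x)\<^sup>2) = 0"
    then have "\<not> norm ((complex_of_real x)\<^sup>2) < R"
      using R(3) by blast
    then show "r \<le> x"
      using x(1) by (simp add: r_def norm_power real_le_lsqrt)
  qed
  moreover have "sqrt (Gamma (\<rho> + \<beta>) / (9 * Gamma \<beta>)) < r"
    using R(4) by (simp add: r_def s)
  moreover have "r < sqrt (9 * Gamma (\<rho> + \<beta>) * Gamma (2 * \<rho> + \<beta>) / Delta 81 25 \<rho> \<beta>)"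
  proof -
    have "rayleigh F 0 / rayleigh F 1 = 9 * Gamma (\<rho> + \<beta>) * Gamma (2 * \<rho> + \<beta>) / Delta 81 25 \<rho> \<beta>"
      unfolding s using G D by (simp add: field_simps power2_eq_square)
    then show ?thesis
      using R(5) by (simp add: r_def)
  qed
  moreover have "root 4 (Gamma (\<rho> + \<beta>) ^ 2 * Gamma (2 * \<rho> + \<beta>) / (Gamma \<beta> * Delta 81 25 \<rho> \<beta>)) < r"
  proof -
    have "R ^ 2 = r ^ 4"
      by (simp flip: r(2))
    then have "root 4 (1 / rayleigh F 1) < root 4 (r ^ 4)"
      using R(6) by simp
    then have "root 4 (1 / rayleigh F 1) < r"
      using r(1) by (simp add: real_root_power_cancel)
    then show ?thesis
      unfolding s by simp
  qed
  moreover have "r < sqrt (2 * Gamma (\<rho> + \<beta>) * Gamma (3 * \<rho> + \<beta>) * Delta 81 25 \<rho> \<beta> /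
              (Gamma \<beta> * Gamma (3 * \<rho> + \<beta>) * Delta 1458 675 \<rho> \<beta>
               + 49 * Gamma (\<rho> + \<beta>) ^ 3 * Gamma (2 * \<rho> + \<beta>)))"
  proof -
    define E where "E = Gamma \<beta> * Gamma (3 * \<rho> + \<beta>) * Delta 1458 675 \<rho> \<beta>
               + 49 * Gamma (\<rho> + \<beta>) ^ 3 * Gamma (2 * \<rho> + \<beta>)"
    \<comment> \<open>Otherwise division by zero would turn the upper bound on \<open>R\<close> into
      \<open>R < 0\<close>.\<close>
    have "rayleigh F 2 \<noteq> 0"
      using R(1,7) by auto
    then have "E \<noteq> 0"
      unfolding s E_def by auto
    then have "rayleigh F 1 / rayleigh F 2 = 2 * Gamma (\<rho> + \<beta>) * Gamma (3 * \<rho> + \<beta>) * Delta 81 25 \<rho> \<beta> / E"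
      unfolding s E_def[symmetric] using G by (simp add: field_simps power2_eq_square power3_eq_cube)
    then show ?thesis
      using R(7) by (simp add: r_def E_def)
  qed
  ultimately show ?thesis by blast
qed

end
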